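(* Let $\Gamma=(F,G,\eta,\rho)$ be a left wide Morita context between the Grothendieck categories $\mathcal A$ and $\mathcal B$ (so $F:\mathcal B\to\mathcal A$, $G:\mathcal A\to\mathcal B$) such that the functors $F$ and $G$ commute with direct limits. Then the quotient categories $\mathcal A/\overline{\mathcal C_\Gamma}$ and $\mathcal B/\overline{\mathcal D_\Gamma}$ are equivalent via the restrictions of the functors $F$ and $G$.
   Context: All functors are additive; subcategory means full subcategory. A left wide Morita context between abelian categories $\mathcal A$ and $\mathcal B$ is a datum $(F,G,\eta,\rho)$ where $F:\mathcal B\to\mathcal A$ and $G:\mathcal A\to\mathcal B$ are left exact functors and $\eta:1_{\mathcal A}\to F\circ G$, $\rho:1_{\mathcal B}\to G\circ F$ are natural transformations with $G\eta=\rho G$ and $F\rho=\eta F$. $\mathcal C_\Gamma=\{M\in\mathcal A\mid\eta(M)=0\}$ and $\mathcal D_\Gamma=\{N\in\mathcal B\mid\rho(N)=0\}$; these are closed subcategories (closed under subobjects, factor objects and arbitrary direct sums). $\overline{\mathcal C_\Gamma}$ and $\overline{\mathcal D_\Gamma}$ denote the smallest localizing subcategories (closed subcategories that are also closed under extensions) containing $\mathcal C_\Gamma$ and $\mathcal D_\Gamma$ respectively. For a localizing subcategory $\mathcal L$ of $\mathcal A$, the quotient category $\mathcal A/\mathcal L$ is identified with the full subcategory of $\mathcal L$-closed objects of $\mathcal A$, i.e. objects $M$ such that no nonzero object of $\mathcal L$ embeds in $M$, and for every monomorphism $i:X'\to X$ with $X/X'\in\mathcal L$ every $f:X'\to M$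 extends along $i$ to $X\to M$. The restrictions of $F$ and $G$ are taken to these subcategories of closed objects. "Direct limits" means filtered (directed) colimits. *)

theory Defs
  imports "HOL-Algebra.Group"
begin

section \<open>Universes\<close>

text \<open>
  A Grothendieck category has coproducts indexed by arbitrary sets of a fixed universe, and its
  Hom-sets belong to that universe.  The universe is represented by a type \<open>'u\<close>: a set (of any
  type) is small if its cardinality is strictly less than that of \<open>'u\<close>, and small index sets are,
  up to bijection, the small subsets of \<open>'u\<close>.  The closure properties say that the cardinality of
  \<open>'u\<close> is an infinite regular strong limit, i.e. it is countably infinite or strongly
  inaccessible; the inaccessible case is the usual notion of universe.
\<close>

definition small :: "'u itself \<Rightarrow> 'x set \<Rightarrow> bool" where
  "small U S \<longleftrightarrow> (card_of S, card_of (UNIV :: 'u set)) \<in> ordLess"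

definition universe :: "'u itself \<Rightarrow> bool" where
  "universe U \<longleftrightarrow>
     infinite (UNIV :: 'u set) \<and>
     (\<forall>I :: 'u set. small U I \<longrightarrow> small U (Pow I)) \<and>
     (\<forall>(I :: 'u set) (S :: 'u \<Rightarrow> 'u set).
        small U I \<longrightarrow> (\<forall>i\<in>I. small U (S i)) \<longrightarrow> small U (\<Union>i\<in>I. S i))"

lemma small_nat: "small TYPE(nat) S \<longleftrightarrow> finite S"
  unfolding small_def finite_iff_ordLess_natLeq
  using card_of_nat ordIso_symmetric ordLess_ordIso_trans by blast

lemma universe_nat: "universe TYPE(nat)"
  by (auto simp: universe_def small_nat)


section \<open>Preadditive categories\<close>

text \<open>
  \<open>Comp C g f\<close>, written \<open>g \<cdot>\<^bsub>C\<^esub> f\<close>, is the composite ``first \<open>f\<close>, then \<open>g\<close>''.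
  \<open>Null C X Y\<close> is the zero morphism from \<open>X\<close> to \<open>Y\<close>.
\<close>

record ('o, 'm) addcat =
  Obj :: "'o set"
  Arr :: "'m set"
  Dom :: "'m \<Rightarrow> 'o"
  Cod :: "'m \<Rightarrow> 'o"
  Ide :: "'o \<Rightarrow> 'm"
  Comp :: "'m \<Rightarrow> 'm \<Rightarrow> 'm"  (infixl "\<cdot>\<index>" 70)
  Add :: "'m \<Rightarrow> 'm \<Rightarrow> 'm"  (infixl "\<oplus>\<index>" 65)
  Null :: "'o \<Rightarrow> 'o \<Rightarrow> 'm"

definition Hom :: "('o, 'm) addcat \<Rightarrow> 'o \<Rightarrow> 'o \<Rightarrow> 'm set" where
  "Hom C X Y = {f \<in> Arr C. Dom C f = X \<and> Cod C f = Y}"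

definition hom_group :: "('o, 'm) addcat \<Rightarrow> 'o \<Rightarrow> 'o \<Rightarrow> 'm monoid" where
  "hom_group C X Y = \<lparr>carrier = Hom C X Y, mult = Add C, one = Null C X Y\<rparr>"

locale category =
  fixes C :: "('o, 'm) addcat" (structure)
  assumes Dom_Obj: "f \<in> Arr C \<Longrightarrow> Dom C f \<in> Obj C"
    and Cod_Obj: "f \<in> Arr C \<Longrightarrow> Cod C f \<in> Obj C"
    and Ide_Hom: "X \<in> Obj C \<Longrightarrow> Ide C X \<in> Hom C X X"
    and Comp_Hom: "\<lbrakk>f \<in> Hom C X Y; g \<in> Hom C Y Z\<rbrakk> \<Longrightarrow> g \<cdot> f \<in> Hom C X Z"
    and Comp_Ide: "f \<in> Hom C X Y \<Longrightarrow> f \<cdot> Ide C X = f"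
    and Ide_Comp: "f \<in> Hom C X Y \<Longrightarrow> Ide C Y \<cdot> f = f"
    and Comp_assoc: "\<lbrakk>f \<in> Hom C W X; g \<in> Hom C X Y; h \<in> Hom C Y Z\<rbrakk>
                       \<Longrightarrow> (h \<cdot> g) \<cdot> f = h \<cdot> (g \<cdot> f)"

locale preadditive_category = category +
  assumes Hom_comm_group: "\<lbrakk>X \<in> Obj C; Y \<in> Obj C\<rbrakk> \<Longrightarrow> comm_group (hom_group C X Y)"
    and Comp_Add: "\<lbrakk>f \<in> Hom C X Y; f' \<in> Hom C X Y; g \<in> Hom C Y Z\<rbrakk>
                     \<Longrightarrow> g \<cdot> (f \<oplus> f') = g \<cdot> f \<oplus> g \<cdot> f'"
    and Add_Comp: "\<lbrakk>f \<in> Hom C X Y; g \<in> Hom C Y Z; g' \<in> Hom C Y Z\<rbrakk>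
                     \<Longrightarrow> (g \<oplus> g') \<cdot> f = g \<cdot> f \<oplus> g' \<cdot> f"

definition is_mono :: "('o, 'm) addcat \<Rightarrow> 'm \<Rightarrow> bool" where
  "is_mono C m \<longleftrightarrow> m \<in> Arr C \<and>
     (\<forall>X. \<forall>f \<in> Hom C X (Dom C m). \<forall>g \<in> Hom C X (Dom C m). m \<cdot>\<^bsub>C\<^esub> f = m \<cdot>\<^bsub>C\<^esub> g \<longrightarrow> f = g)"

definition is_epi :: "('o, 'm) addcat \<Rightarrow> 'm \<Rightarrow> bool" where
  "is_epi C e \<longleftrightarrow> e \<in> Arr C \<and>
     (\<forall>Y. \<forall>f \<in> Hom C (Cod C e) Y. \<forall>g \<in> Hom C (Cod C e) Y. f \<cdot>\<^bsub>C\<^esub> e = g \<cdot>\<^bsub>C\<^esub> e \<longrightarrow> f = g)"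

definition is_iso :: "('o, 'm) addcat \<Rightarrow> 'm \<Rightarrow> bool" where
  "is_iso C f \<longleftrightarrow> f \<in> Arr C \<and>
     (\<exists>g \<in> Hom C (Cod C f) (Dom C f).
        g \<cdot>\<^bsub>C\<^esub> f = Ide C (Dom C f) \<and> f \<cdot>\<^bsub>C\<^esub> g = Ide C (Cod C f))"

definition is_zero_object :: "('o, 'm) addcat \<Rightarrow> 'o \<Rightarrow> bool" where
  "is_zero_object C Z \<longleftrightarrow> Z \<in> Obj C \<and>
     (\<forall>X \<in> Obj C. (\<exists>!f. f \<in> Hom C Z X) \<and> (\<exists>!f. f \<in> Hom C X Z))"

definition is_kernel :: "('o, 'm) addcat \<Rightarrow> 'm \<Rightarrow> 'm \<Rightarrow> bool" where
  "is_kernel C k f \<longleftrightarrow> k \<in> Arr C \<and> f \<in> Arr C \<and> Cod C k = Dom C f \<and>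
     f \<cdot>\<^bsub>C\<^esub> k = Null C (Dom C k) (Cod C f) \<and>
     (\<forall>X. \<forall>h \<in> Hom C X (Dom C f). f \<cdot>\<^bsub>C\<^esub> h = Null C X (Cod C f) \<longrightarrow>
        (\<exists>!u. u \<in> Hom C X (Dom C k) \<and> k \<cdot>\<^bsub>C\<^esub> u = h))"

definition is_cokernel :: "('o, 'm) addcat \<Rightarrow> 'm \<Rightarrow> 'm \<Rightarrow> bool" where
  "is_cokernel C q f \<longleftrightarrow> q \<in> Arr C \<and> f \<in> Arr C \<and> Dom C q = Cod C f \<and>
     q \<cdot>\<^bsub>C\<^esub> f = Null C (Dom C f) (Cod C q) \<and>
     (\<forall>Y. \<forall>h \<in> Hom C (Cod C f) Y. h \<cdot>\<^bsub>C\<^esub> f = Null C (Dom C f) Y \<longrightarrow>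
        (\<exists>!u. u \<in> Hom C (Cod C q) Y \<and> u \<cdot>\<^bsub>C\<^esub> q = h))"

definition is_biproduct ::
  "('o, 'm) addcat \<Rightarrow> 'o \<Rightarrow> 'o \<Rightarrow> 'o \<Rightarrow> 'm \<Rightarrow> 'm \<Rightarrow> 'm \<Rightarrow> 'm \<Rightarrow> bool" where
  "is_biproduct C X Y P i j p q \<longleftrightarrow>
     P \<in> Obj C \<and> i \<in> Hom C X P \<and> j \<in> Hom C Y P \<and> p \<in> Hom C P X \<and> q \<in> Hom C P Y \<and>
     p \<cdot>\<^bsub>C\<^esub> i = Ide C X \<and> q \<cdot>\<^bsub>C\<^esub> j = Ide C Y \<and>
     p \<cdot>\<^bsub>C\<^esub> j = Null C Y X \<and> q \<cdot>\<^bsub>C\<^esub> i = Null C X Y \<and>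
     i \<cdot>\<^bsub>C\<^esub> p \<oplus>\<^bsub>C\<^esub> j \<cdot>\<^bsub>C\<^esub> q = Ide C P"

text \<open>\<open>0 \<rightarrow> X \<rightarrow> Y \<rightarrow> Z \<rightarrow> 0\<close> with \<open>f\<close> the first and \<open>g\<close> the second inner arrow.\<close>

definition short_exact :: "('o, 'm) addcat \<Rightarrow> 'm \<Rightarrow> 'm \<Rightarrow> bool" where
  "short_exact C f g \<longleftrightarrow> is_kernel C f g \<and> is_cokernel C g f"


section \<open>Abelian and Grothendieck categories\<close>

locale abelian_category = preadditive_category +
  assumes has_zero_object: "\<exists>Z. is_zero_object C Z"
    and has_biproducts: "\<lbrakk>X \<in> Obj C; Y \<in> Obj C\<rbrakk> \<Longrightarrow> \<exists>P i j p q. is_biproduct C X Y P i j p q"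
    and has_kernels: "f \<in> Arr C \<Longrightarrow> \<exists>k. is_kernel C k f"
    and has_cokernels: "f \<in> Arr C \<Longrightarrow> \<exists>q. is_cokernel C q f"
    and mono_normal: "is_mono C m \<Longrightarrow> \<exists>f. is_kernel C m f"
    and epi_normal: "is_epi C e \<Longrightarrow> \<exists>f. is_cokernel C e f"

definition is_coproduct ::
  "('o, 'm) addcat \<Rightarrow> 'i set \<Rightarrow> ('i \<Rightarrow> 'o) \<Rightarrow> 'o \<Rightarrow> ('i \<Rightarrow> 'm) \<Rightarrow> bool" where
  "is_coproduct C I X S \<iota> \<longleftrightarrow> S \<in> Obj C \<and> (\<forall>i\<in>I. \<iota> i \<in> Hom C (X i) S) \<and>
     (\<forall>Y \<in> Obj C. \<forall>f. (\<forall>i\<in>I. f i \<in> Hom C (X i) Y) \<longrightarrow>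
        (\<exists>!h. h \<in> Hom C S Y \<and> (\<forall>i\<in>I. h \<cdot>\<^bsub>C\<^esub> \<iota> i = f i)))"

definition directed_set :: "'i set \<Rightarrow> ('i \<times> 'i) set \<Rightarrow> bool" where
  "directed_set I r \<longleftrightarrow> preorder_on I r \<and> I \<noteq> {} \<and>
     (\<forall>i\<in>I. \<forall>j\<in>I. \<exists>k\<in>I. (i, k) \<in> r \<and> (j, k) \<in> r)"

definition directed_system ::
  "('o, 'm) addcat \<Rightarrow> 'i set \<Rightarrow> ('i \<times> 'i) set \<Rightarrow> ('i \<Rightarrow> 'o) \<Rightarrow> ('i \<Rightarrow> 'i \<Rightarrow> 'm) \<Rightarrow> bool" where
  "directed_system C I r X \<phi> \<longleftrightarrow> directed_set I r \<and> (\<forall>i\<in>I. X i \<in> Obj C) \<and>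
     (\<forall>(i, j) \<in> r. \<phi> i j \<in> Hom C (X i) (X j)) \<and>
     (\<forall>i\<in>I. \<phi> i i = Ide C (X i)) \<and>
     (\<forall>i j k. (i, j) \<in> r \<longrightarrow> (j, k) \<in> r \<longrightarrow> \<phi> j k \<cdot>\<^bsub>C\<^esub> \<phi> i j = \<phi> i k)"

definition is_cocone ::
  "('o, 'm) addcat \<Rightarrow> 'i set \<Rightarrow> ('i \<times> 'i) set \<Rightarrow> ('i \<Rightarrow> 'o) \<Rightarrow> ('i \<Rightarrow> 'i \<Rightarrow> 'm)
     \<Rightarrow> 'o \<Rightarrow> ('i \<Rightarrow> 'm) \<Rightarrow> bool" where
  "is_cocone C I r X \<phi> Y c \<longleftrightarrow> Y \<in> Obj C \<and> (\<forall>i\<in>I. c i \<in> Hom C (X i) Y) \<and>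
     (\<forall>(i, j) \<in> r. c j \<cdot>\<^bsub>C\<^esub> \<phi> i j = c i)"

definition is_direct_limit ::
  "('o, 'm) addcat \<Rightarrow> 'i set \<Rightarrow> ('i \<times> 'i) set \<Rightarrow> ('i \<Rightarrow> 'o) \<Rightarrow> ('i \<Rightarrow> 'i \<Rightarrow> 'm)
     \<Rightarrow> 'o \<Rightarrow> ('i \<Rightarrow> 'm) \<Rightarrow> bool" where
  "is_direct_limit C I r X \<phi> L l \<longleftrightarrow> directed_system C I r X \<phi> \<and> is_cocone C I r X \<phi> L l \<and>
     (\<forall>Y c. is_cocone C I r X \<phi> Y c \<longrightarrow>
        (\<exists>!h. h \<in> Hom C L Y \<and> (\<forall>i\<in>I. h \<cdot>\<^bsub>C\<^esub> l i = c i)))"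

definition system_morphism ::
  "('o, 'm) addcat \<Rightarrow> 'i set \<Rightarrow> ('i \<times> 'i) set \<Rightarrow> ('i \<Rightarrow> 'o) \<Rightarrow> ('i \<Rightarrow> 'i \<Rightarrow> 'm)
     \<Rightarrow> ('i \<Rightarrow> 'o) \<Rightarrow> ('i \<Rightarrow> 'i \<Rightarrow> 'm) \<Rightarrow> ('i \<Rightarrow> 'm) \<Rightarrow> bool" where
  "system_morphism C I r X \<phi> Y \<psi> u \<longleftrightarrow> (\<forall>i\<in>I. u i \<in> Hom C (X i) (Y i)) \<and>
     (\<forall>(i, j) \<in> r. u j \<cdot>\<^bsub>C\<^esub> \<phi> i j = \<psi> i j \<cdot>\<^bsub>C\<^esub> u i)"

text \<open>
  In the last axiom \<open>f\<close> and \<open>g\<close> are the morphisms induced between the direct limits.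
  Existence of small direct limits follows from that of small coproducts and cokernels.
\<close>

locale grothendieck_category = abelian_category C
  for U :: "'u itself" and C :: "('o, 'm) addcat" (structure) +
  assumes locally_small: "\<lbrakk>X \<in> Obj C; Y \<in> Obj C\<rbrakk> \<Longrightarrow> small U (Hom C X Y)"
    and has_generator:
      "\<exists>G \<in> Obj C. \<forall>X Y. \<forall>f \<in> Hom C X Y. \<forall>g \<in> Hom C X Y.
         f \<noteq> g \<longrightarrow> (\<exists>h \<in> Hom C G X. f \<cdot> h \<noteq> g \<cdot> h)"
    and has_coproducts:
      "\<And>(I :: 'u set) X. \<lbrakk>small U I; \<forall>i\<in>I. X i \<in> Obj C\<rbrakk> \<Longrightarrow> \<exists>S \<iota>. is_coproduct C I X S \<iota>"
    and direct_limits_exact: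
      "\<And>(I :: 'u set) r X \<phi> Y \<psi> Z \<chi> u v LX lX LY lY LZ lZ f g.
         \<lbrakk>small U I;
          is_direct_limit C I r X \<phi> LX lX;
          is_direct_limit C I r Y \<psi> LY lY;
          is_direct_limit C I r Z \<chi> LZ lZ;
          system_morphism C I r X \<phi> Y \<psi> u;
          system_morphism C I r Y \<psi> Z \<chi> v;
          \<forall>i\<in>I. short_exact C (u i) (v i);
          f \<in> Hom C LX LY; \<forall>i\<in>I. f \<cdot> lX i = lY i \<cdot> u i;
          g \<in> Hom C LY LZ; \<forall>i\<in>I. g \<cdot> lY i = lZ i \<cdot> v i\<rbrakk>
         \<Longrightarrow> short_exact C f g"


section \<open>Functors and natural transformations\<close>

record ('o1, 'm1, 'o2, 'm2) funct =
  omap :: "'o1 \<Rightarrow> 'o2"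
  amap :: "'m1 \<Rightarrow> 'm2"

definition additive_functor ::
  "('o1, 'm1) addcat \<Rightarrow> ('o2, 'm2) addcat \<Rightarrow> ('o1, 'm1, 'o2, 'm2) funct \<Rightarrow> bool" where
  "additive_functor C D F \<longleftrightarrow>
     (\<forall>X \<in> Obj C. omap F X \<in> Obj D) \<and>
     (\<forall>X Y. \<forall>f \<in> Hom C X Y. amap F f \<in> Hom D (omap F X) (omap F Y)) \<and>
     (\<forall>X \<in> Obj C. amap F (Ide C X) = Ide D (omap F X)) \<and>
     (\<forall>X Y Z. \<forall>f \<in> Hom C X Y. \<forall>g \<in> Hom C Y Z.
        amap F (g \<cdot>\<^bsub>C\<^esub> f) = amap F g \<cdot>\<^bsub>D\<^esub> amap F f) \<and>
     (\<forall>X Y. \<forall>f \<in> Hom C X Y. \<forall>g \<in> Hom C X Y.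
        amap F (f \<oplus>\<^bsub>C\<^esub> g) = amap F f \<oplus>\<^bsub>D\<^esub> amap F g)"

text \<open>\<open>0 \<rightarrow> X \<rightarrow> Y \<rightarrow> Z\<close> is exact iff its first arrow is a kernel of its second arrow.\<close>

definition left_exact ::
  "('o1, 'm1) addcat \<Rightarrow> ('o2, 'm2) addcat \<Rightarrow> ('o1, 'm1, 'o2, 'm2) funct \<Rightarrow> bool" where
  "left_exact C D F \<longleftrightarrow> additive_functor C D F \<and>
     (\<forall>f g. is_kernel C f g \<longrightarrow> is_kernel D (amap F f) (amap F g))"

definition preserves_direct_limits ::
  "'u itself \<Rightarrow> ('o1, 'm1) addcat \<Rightarrow> ('o2, 'm2) addcat \<Rightarrow> ('o1, 'm1, 'o2, 'm2) funct \<Rightarrow> bool" where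
  "preserves_direct_limits U C D F \<longleftrightarrow>
     (\<forall>(I :: 'u set) r X \<phi> L l. small U I \<longrightarrow> is_direct_limit C I r X \<phi> L l \<longrightarrow>
        is_direct_limit D I r (\<lambda>i. omap F (X i)) (\<lambda>i j. amap F (\<phi> i j))
          (omap F L) (\<lambda>i. amap F (l i)))"

definition id_functor :: "('o, 'm, 'o, 'm) funct" where
  "id_functor = \<lparr>omap = (\<lambda>X. X), amap = (\<lambda>f. f)\<rparr>"

definition comp_functor ::
  "('o2, 'm2, 'o3, 'm3) funct \<Rightarrow> ('o1, 'm1, 'o2, 'm2) funct \<Rightarrow> ('o1, 'm1, 'o3, 'm3) funct" where
  "comp_functor G F = \<lparr>omap = omap G \<circ> omap F, amap = amap G \<circ> amap F\<rparr>"

definition natural_transformation ::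
  "('o1, 'm1) addcat \<Rightarrow> ('o2, 'm2) addcat \<Rightarrow> ('o1, 'm1, 'o2, 'm2) funct
     \<Rightarrow> ('o1, 'm1, 'o2, 'm2) funct \<Rightarrow> ('o1 \<Rightarrow> 'm2) \<Rightarrow> bool" where
  "natural_transformation C D F G \<tau> \<longleftrightarrow>
     (\<forall>X \<in> Obj C. \<tau> X \<in> Hom D (omap F X) (omap G X)) \<and>
     (\<forall>X Y. \<forall>f \<in> Hom C X Y. \<tau> Y \<cdot>\<^bsub>D\<^esub> amap F f = amap G f \<cdot>\<^bsub>D\<^esub> \<tau> X)"

definition natural_isomorphism ::
  "('o1, 'm1) addcat \<Rightarrow> ('o2, 'm2) addcat \<Rightarrow> ('o1, 'm1, 'o2, 'm2) funct
     \<Rightarrow> ('o1, 'm1, 'o2, 'm2) funct \<Rightarrow> ('o1 \<Rightarrow> 'm2) \<Rightarrow> bool" where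
  "natural_isomorphism C D F G \<tau> \<longleftrightarrow>
     natural_transformation C D F G \<tau> \<and> (\<forall>X \<in> Obj C. is_iso D (\<tau> X))"

text \<open>\<open>F : D \<rightarrow> C\<close> and \<open>G : C \<rightarrow> D\<close> are mutually quasi-inverse equivalences.\<close>

definition inverse_equivalences ::
  "('o1, 'm1) addcat \<Rightarrow> ('o2, 'm2) addcat \<Rightarrow> ('o2, 'm2, 'o1, 'm1) funct
     \<Rightarrow> ('o1, 'm1, 'o2, 'm2) funct \<Rightarrow> bool" where
  "inverse_equivalences C D F G \<longleftrightarrow> additive_functor D C F \<and> additive_functor C D G \<and>
     (\<exists>\<alpha>. natural_isomorphism C C id_functor (comp_functor F G) \<alpha>) \<and>
     (\<exists>\<beta>. natural_isomorphism D D id_functor (comp_functor G F) \<beta>)"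


section \<open>Localizing subcategories and closed objects\<close>

text \<open>
  Full subcategories are given by sets of objects.  A functor is restricted to a full subcategory
  by leaving its underlying maps unchanged: \<^const>\<open>additive_functor\<close> only looks at the objects
  and arrows of the source category, and demands that they be sent into the target category.
\<close>

definition full_subcategory :: "('o, 'm) addcat \<Rightarrow> 'o set \<Rightarrow> ('o, 'm) addcat" where
  "full_subcategory C S =
     C\<lparr>Obj := Obj C \<inter> S, Arr := {f \<in> Arr C. Dom C f \<in> S \<and> Cod C f \<in> S}\<rparr>"

definition closed_subcategory :: "'u itself \<Rightarrow> ('o, 'm) addcat \<Rightarrow> 'o set \<Rightarrow> bool" where
  "closed_subcategory U C L \<longleftrightarrow> L \<subseteq> Obj C \<and>
     (\<forall>m. is_mono C m \<longrightarrow> Cod C m \<in> L \<longrightarrow> Dom C m \<in> L) \<and>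
     (\<forall>e. is_epi C e \<longrightarrow> Dom C e \<in> L \<longrightarrow> Cod C e \<in> L) \<and>
     (\<forall>(I :: 'u set) X S \<iota>. small U I \<longrightarrow> (\<forall>i\<in>I. X i \<in> L) \<longrightarrow>
        is_coproduct C I X S \<iota> \<longrightarrow> S \<in> L)"

definition localizing_subcategory :: "'u itself \<Rightarrow> ('o, 'm) addcat \<Rightarrow> 'o set \<Rightarrow> bool" where
  "localizing_subcategory U C L \<longleftrightarrow> closed_subcategory U C L \<and>
     (\<forall>f g. short_exact C f g \<longrightarrow> Dom C f \<in> L \<longrightarrow> Cod C g \<in> L \<longrightarrow> Cod C f \<in> L)"

definition localizing_closure :: "'u itself \<Rightarrow> ('o, 'm) addcat \<Rightarrow> 'o set \<Rightarrow> 'o set" where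
  "localizing_closure U C S = \<Inter>{L. localizing_subcategory U C L \<and> S \<subseteq> L}"

lemma localizing_closure_least:
  "\<lbrakk>localizing_subcategory U C L; S \<subseteq> L\<rbrakk> \<Longrightarrow> localizing_closure U C S \<subseteq> L"
  by (auto simp: localizing_closure_def)

lemma localizing_closure_superset: "S \<subseteq> localizing_closure U C S"
  by (auto simp: localizing_closure_def)

lemma (in category) localizing_closure_localizing:
  fixes U :: "'u itself"
  assumes "S \<subseteq> Obj C"
  shows "localizing_subcategory U C (localizing_closure U C S)"
proof -
  have "localizing_subcategory U C (Obj C)"
    by (auto simp: localizing_subcategory_def closed_subcategory_def is_mono_def is_epi_def
        is_coproduct_def short_exact_def is_kernel_def Dom_Obj Cod_Obj)
  hence "localizing_closure U C S \<subseteq> Obj C"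
    using assms by (rule localizing_closure_least)
  moreover have "T \<in> localizing_closure U C S"
    if "small U I" "\<forall>i\<in>I. X i \<in> localizing_closure U C S" "is_coproduct C I X T \<iota>"
    for I :: "'u set" and X T \<iota>
    unfolding localizing_closure_def
  proof (intro InterI, safe)
    fix L assume L: "localizing_subcategory U C L" "S \<subseteq> L"
    hence "\<forall>i\<in>I. X i \<in> L"
      using that(2) localizing_closure_least by blast
    thus "T \<in> L"
      using L that(1,3) unfolding localizing_subcategory_def closed_subcategory_def by blast
  qed
  moreover have "Dom C m \<in> localizing_closure U C S"
    if "is_mono C m" "Cod C m \<in> localizing_closure U C S" for m
    using that by (auto simp: localizing_closure_def localizing_subcategory_def closed_subcategory_def)
  moreover have "Cod C e \<in> localizing_closure U C S"
    if "is_epi C e" "Dom C e \<in> localizing_closure U C S" for e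
    using that by (auto simp: localizing_closure_def localizing_subcategory_def closed_subcategory_def)
  moreover have "Cod C f \<in> localizing_closure U C S"
    if "short_exact C f g" "Dom C f \<in> localizing_closure U C S"
      "Cod C g \<in> localizing_closure U C S" for f g
    using that by (auto simp: localizing_closure_def localizing_subcategory_def)
  ultimately show ?thesis
    unfolding localizing_subcategory_def closed_subcategory_def by blast
qed

text \<open>The objects that represent the quotient category \<open>C/L\<close>.\<close>

definition closed_objects :: "('o, 'm) addcat \<Rightarrow> 'o set \<Rightarrow> 'o set" where
  "closed_objects C L = {M \<in> Obj C.
     (\<forall>m. is_mono C m \<longrightarrow> Cod C m = M \<longrightarrow> Dom C m \<in> L \<longrightarrow> is_zero_object C (Dom C m)) \<and>
     (\<forall>i q. is_mono C i \<longrightarrow> is_cokernel C q i \<longrightarrow> Cod C q \<in> L \<longrightarrow>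
        (\<forall>f \<in> Hom C (Dom C i) M. \<exists>h \<in> Hom C (Cod C i) M. h \<cdot>\<^bsub>C\<^esub> i = f))}"

definition quotient_category :: "('o, 'm) addcat \<Rightarrow> 'o set \<Rightarrow> ('o, 'm) addcat" where
  "quotient_category C L = full_subcategory C (closed_objects C L)"


section \<open>Left wide Morita contexts\<close>

locale left_wide_Morita_context =
  A: abelian_category A + B: abelian_category B
  for A :: "('oa, 'ma) addcat" and B :: "('ob, 'mb) addcat" +
  fixes F :: "('ob, 'mb, 'oa, 'ma) funct" and G :: "('oa, 'ma, 'ob, 'mb) funct"
    and \<eta> :: "'oa \<Rightarrow> 'ma" and \<rho> :: "'ob \<Rightarrow> 'mb"
  assumes F_left_exact: "left_exact B A F"
    and G_left_exact: "left_exact A B G"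
    and \<eta>_natural: "natural_transformation A A id_functor (comp_functor F G) \<eta>"
    and \<rho>_natural: "natural_transformation B B id_functor (comp_functor G F) \<rho>"
    and G_\<eta>: "M \<in> Obj A \<Longrightarrow> amap G (\<eta> M) = \<rho> (omap G M)"
    and F_\<rho>: "N \<in> Obj B \<Longrightarrow> amap F (\<rho> N) = \<eta> (omap F N)"

text \<open>
  The objects at which a natural transformation \<open>1 \<rightarrow> T\<close> vanishes: for \<open>T = F \<circ> G\<close> and
  \<open>\<eta>\<close> this is \<open>\<C>\<^sub>\<Gamma>\<close>, for \<open>T = G \<circ> F\<close> and \<open>\<rho>\<close> it is \<open>\<D>\<^sub>\<Gamma>\<close>.
\<close>

definition vanishing_objects ::
  "('o, 'm) addcat \<Rightarrow> ('o, 'm, 'o, 'm) funct \<Rightarrow> ('o \<Rightarrow> 'm) \<Rightarrow> 'o set" where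
  "vanishing_objects C T \<tau> = {M \<in> Obj C. \<tau> M = Null C M (omap T M)}"

end

(* The naturality of \<eta> and \<rho> together with G \<eta> = \<rho> G and F \<rho> = \<eta> F gives
   that kernel and cokernel of every \<eta>(M) lie in C.  If M is closed for a localizing subcategory
   containing C, then \<eta>(M) is therefore a monomorphism, the identity of M extends along it to a
   retraction, and \<eta>(M) is invertible because \<eta>(FGM) = FG(\<eta>(M)) is a monomorphism as well.
   It remains to see that G preserves closed objects, by symmetry also F.  An extension problem
   for a map into G M is transported to A by F, solved in M, and transported back along \<rho>; for this
   F has to send the localizing closure of D into that of C.  This is where direct limits enter:
   the objects all of whose quotients are sent by F into a given localizing subcategory form a
   localizing subcategory themselves, since a quotient of a coproduct is, by exactness of direct
   limits, the directed union of the images of the finite partial coproducts. *)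

theory Submission
  imports Defs
begin

section \<open>Preadditive and abelian categories\<close>

text \<open>Two failures of right exactness shape the proof. As \<open>F\<close> need not preserve
  epimorphisms, the objects that it sends into a localizing \<open>T\<close> need not be closed
  under factor objects; asking that all their quotients go into \<open>T\<close> repairs this and
  costs nothing on \<open>\<D>\<close>, which is closed under quotients and mapped into
  \<open>\<C>\<close>. Likewise \<open>F\<close> turns \<open>0 -> X -> Y -> Q -> 0\<close> only
  into a left exact sequence, but the cokernel of \<open>F X -> F Y\<close> still embeds in
  \<open>F Q\<close>, and \<open>T\<close> is closed under subobjects. This saves both the extension
  problems and the extension closure of the strengthened class. The cokernel \<open>q\<close> of
  \<open>\<eta> M\<close> is within reach without right exactness, because
  \<open>\<eta> (F G M) = F G (\<eta> M)\<close> moves the relation that \<open>q\<close> kills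
  \<open>\<eta> M\<close> inside the functors. The Grothendieck axioms give coproducts and exactness
  of direct limits. That direct limits exist, and that a directed union of subobjects is one, has to
  be derived before \<open>preserves_direct_limits\<close> can be applied.\<close>

context category
begin

lemma Hom_Obj: "f \<in> Hom C X Y \<Longrightarrow> X \<in> Obj C" "f \<in> Hom C X Y \<Longrightarrow> Y \<in> Obj C"
  using Dom_Obj Cod_Obj by (auto simp: Hom_def)

lemma Arr_Hom: "f \<in> Arr C \<Longrightarrow> f \<in> Hom C (Dom C f) (Cod C f)"
  by (simp add: Hom_def)

lemma HomD: "f \<in> Hom C X Y \<Longrightarrow> f \<in> Arr C \<and> Dom C f = X \<and> Cod C f = Y"
  by (simp add: Hom_def)

lemma monoD:
  "\<lbrakk>is_mono C m; m \<in> Hom C X Y; f \<in> Hom C W X; g \<in> Hom C W X; m \<cdot> f = m \<cdot> g\<rbrakk> \<Longrightarrow> f = g"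
  unfolding is_mono_def Hom_def by blast

lemma epiD:
  "\<lbrakk>is_epi C e; e \<in> Hom C X Y; f \<in> Hom C Y W; g \<in> Hom C Y W; f \<cdot> e = g \<cdot> e\<rbrakk> \<Longrightarrow> f = g"
  unfolding is_epi_def Hom_def by blast

lemma split_mono:
  assumes f: "f \<in> Hom C X Y" and g: "g \<in> Hom C Y X" and gf: "g \<cdot> f = Ide C X"
  shows "is_mono C f"
  unfolding is_mono_def
proof (intro conjI allI ballI impI)
  show "f \<in> Arr C" using HomD[OF f] by simp
  fix W x y
  assume "x \<in> Hom C W (Dom C f)" "y \<in> Hom C W (Dom C f)" and fxy: "f \<cdot> x = f \<cdot> y"
  hence x: "x \<in> Hom C W X" and y: "y \<in> Hom C W X" using HomD[OF f] by auto
  have "x = (g \<cdot> f) \<cdot> x" using gf Ide_Comp[OF x] by simp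
  also have "\<dots> = (g \<cdot> f) \<cdot> y" using Comp_assoc[OF x f g] Comp_assoc[OF y f g] fxy by simp
  also have "\<dots> = y" using gf Ide_Comp[OF y] by simp
  finally show "x = y" .
qed

lemma split_epi:
  assumes f: "f \<in> Hom C X Y" and g: "g \<in> Hom C Y X" and fg: "f \<cdot> g = Ide C Y"
  shows "is_epi C f"
  unfolding is_epi_def
proof (intro conjI allI ballI impI)
  show "f \<in> Arr C" using HomD[OF f] by simp
  fix W x y
  assume "x \<in> Hom C (Cod C f) W" "y \<in> Hom C (Cod C f) W" and fxy: "x \<cdot> f = y \<cdot> f"
  hence x: "x \<in> Hom C Y W" and y: "y \<in> Hom C Y W" using HomD[OF f] by auto
  have "x = x \<cdot> (f \<cdot> g)" using fg Comp_Ide[OF x] by simp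
  also have "\<dots> = y \<cdot> (f \<cdot> g)" using Comp_assoc[OF g f x] Comp_assoc[OF g f y] fxy by simp
  also have "\<dots> = y" using fg Comp_Ide[OF y] by simp
  finally show "x = y" .
qed

lemma epi_comp:
  assumes e: "is_epi C e" "e \<in> Hom C X Y" and d: "is_epi C d" "d \<in> Hom C Y Z"
  shows "is_epi C (d \<cdot> e)"
  unfolding is_epi_def
proof (intro conjI allI ballI impI)
  have de: "d \<cdot> e \<in> Hom C X Z" using Comp_Hom e d by blast
  show "d \<cdot> e \<in> Arr C" using HomD[OF de] by simp
  fix W x y
  assume "x \<in> Hom C (Cod C (d \<cdot> e)) W" "y \<in> Hom C (Cod C (d \<cdot> e)) W" and xy: "x \<cdot> (d \<cdot> e) = y \<cdot> (d \<cdot> e)"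
  hence x: "x \<in> Hom C Z W" and y: "y \<in> Hom C Z W" using HomD[OF de] by auto
  have "(x \<cdot> d) \<cdot> e = (y \<cdot> d) \<cdot> e"
    using xy Comp_assoc[OF e(2) d(2) x] Comp_assoc[OF e(2) d(2) y] by simp
  hence "x \<cdot> d = y \<cdot> d" using epiD[OF e(1,2)] Comp_Hom d(2) x y by blast
  thus "x = y" using epiD[OF d x y] by blast
qed

lemma epi_of_comp:
  assumes f: "f \<in> Hom C X Y" and g: "g \<in> Hom C Y Z" and gf: "is_epi C (g \<cdot> f)"
  shows "is_epi C g"
  unfolding is_epi_def
proof (intro conjI allI ballI impI)
  show "g \<in> Arr C" using HomD[OF g] by simp
  fix W x y
  assume "x \<in> Hom C (Cod C g) W" "y \<in> Hom C (Cod C g) W" and xy: "x \<cdot> g = y \<cdot> g"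
  hence x: "x \<in> Hom C Z W" and y: "y \<in> Hom C Z W" using HomD[OF g] by auto
  have "x \<cdot> (g \<cdot> f) = y \<cdot> (g \<cdot> f)"
    using xy Comp_assoc[OF f g x] Comp_assoc[OF f g y] by simp
  thus "x = y" using epiD[OF gf Comp_Hom[OF f g] x y] by blast
qed

end

section \<open>Zero morphisms, kernels and cokernels\<close>

context preadditive_category
begin

lemma hom_group_simps [simp]:
  "carrier (hom_group C X Y) = Hom C X Y"
  "monoid.mult (hom_group C X Y) = Add C"
  "one (hom_group C X Y) = Null C X Y"
  by (simp_all add: hom_group_def)

lemma Null_Hom: "\<lbrakk>X \<in> Obj C; Y \<in> Obj C\<rbrakk> \<Longrightarrow> Null C X Y \<in> Hom C X Y"
  using comm_group.axioms(2)[OF Hom_comm_group, THEN group.is_monoid, THEN monoid.one_closed] by auto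

lemma Null_Add: "f \<in> Hom C X Y \<Longrightarrow> Null C X Y \<oplus> f = f"
  using comm_group.axioms(2)[OF Hom_comm_group, THEN group.is_monoid, THEN monoid.l_one, of X Y f]
  by (auto dest: Hom_Obj)

lemma Add_cancel: "\<lbrakk>f \<in> Hom C X Y; g \<in> Hom C X Y; f \<oplus> g = g\<rbrakk> \<Longrightarrow> f = Null C X Y"
  using group.l_cancel_one'[OF comm_group.axioms(2)[OF Hom_comm_group], of X Y g f]
    comm_groupE(4)[OF Hom_comm_group, of X Y f g]
  by (auto dest: Hom_Obj)

lemma Add_Null: "f \<in> Hom C X Y \<Longrightarrow> f \<oplus> Null C X Y = f"
  using comm_group.axioms(2)[OF Hom_comm_group, THEN group.is_monoid, THEN monoid.r_one, of X Y f]
  by (auto dest: Hom_Obj)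

lemma Add_Hom: "\<lbrakk>f \<in> Hom C X Y; g \<in> Hom C X Y\<rbrakk> \<Longrightarrow> f \<oplus> g \<in> Hom C X Y"
  using comm_group.axioms(2)[OF Hom_comm_group, THEN group.is_monoid, THEN monoid.m_closed, of X Y f g]
  by (auto dest: Hom_Obj)

text \<open>Subtraction is offered as solvability of an equation, so that inverses in the Hom-groups
  do not appear outside this proof.\<close>

lemma difference:
  assumes f: "f \<in> Hom C X Y" and g: "g \<in> Hom C X Y"
  obtains d where "d \<in> Hom C X Y" "d \<oplus> g = f"
proof -
  interpret H: comm_group "hom_group C X Y"
    by (rule Hom_comm_group) (use Hom_Obj[OF f] in auto)
  let ?d = "f \<oplus> inv\<^bsub>hom_group C X Y\<^esub> g"
  show thesis
    using that[of ?d] H.m_closed[of f "inv\<^bsub>hom_group C X Y\<^esub> g"] H.inv_closed[of g]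
      H.m_assoc[of f "inv\<^bsub>hom_group C X Y\<^esub> g" g] H.l_inv[of g] H.r_one[of f] f g by simp
qed

lemma Comp_Null:
  assumes g: "g \<in> Hom C Y Z" and X: "X \<in> Obj C"
  shows "g \<cdot> Null C X Y = Null C X Z"
proof -
  have N: "Null C X Y \<in> Hom C X Y" using Null_Hom X Hom_Obj[OF g] by blast
  have "g \<cdot> Null C X Y \<oplus> g \<cdot> Null C X Y = g \<cdot> (Null C X Y \<oplus> Null C X Y)"
    using Comp_Add[OF N N g] by simp
  also have "\<dots> = g \<cdot> Null C X Y" using Null_Add[OF N] by simp
  finally show ?thesis using Add_cancel Comp_Hom[OF N g] by blast
qed

lemma Null_Comp:
  assumes f: "f \<in> Hom C X Y" and Z: "Z \<in> Obj C"
  shows "Null C Y Z \<cdot> f = Null C X Z"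
proof -
  have N: "Null C Y Z \<in> Hom C Y Z" using Null_Hom Z Hom_Obj[OF f] by blast
  have "Null C Y Z \<cdot> f \<oplus> Null C Y Z \<cdot> f = (Null C Y Z \<oplus> Null C Y Z) \<cdot> f"
    using Add_Comp[OF f N N] by simp
  also have "\<dots> = Null C Y Z \<cdot> f" using Null_Add[OF N] by simp
  finally show ?thesis using Add_cancel Comp_Hom[OF f N] by blast
qed

lemma monoI:
  assumes m: "m \<in> Hom C X Y"
    and null: "\<And>W d. \<lbrakk>d \<in> Hom C W X; m \<cdot> d = Null C W Y\<rbrakk> \<Longrightarrow> d = Null C W X"
  shows "is_mono C m"
  unfolding is_mono_def
proof (intro conjI allI ballI impI)
  show "m \<in> Arr C" using HomD[OF m] by simp
  fix W f g
  assume "f \<in> Hom C W (Dom C m)" "g \<in> Hom C W (Dom C m)" and mfg: "m \<cdot> f = m \<cdot> g"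
  hence f: "f \<in> Hom C W X" and g: "g \<in> Hom C W X" using HomD[OF m] by auto
  obtain d where d: "d \<in> Hom C W X" "d \<oplus> g = f" using difference[OF f g] .
  have "m \<cdot> d \<oplus> m \<cdot> g = m \<cdot> g" using Comp_Add[OF d(1) g m] d(2) mfg by simp
  hence "d = Null C W X" using Add_cancel[OF Comp_Hom[OF d(1) m] Comp_Hom[OF g m]] null d by blast
  thus "f = g" using d Null_Add[OF g] by simp
qed

lemma epiI:
  assumes e: "e \<in> Hom C X Y"
    and null: "\<And>W d. \<lbrakk>d \<in> Hom C Y W; d \<cdot> e = Null C X W\<rbrakk> \<Longrightarrow> d = Null C Y W"
  shows "is_epi C e"
  unfolding is_epi_def
proof (intro conjI allI ballI impI)
  show "e \<in> Arr C" using HomD[OF e] by simp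
  fix W f g
  assume "f \<in> Hom C (Cod C e) W" "g \<in> Hom C (Cod C e) W" and efg: "f \<cdot> e = g \<cdot> e"
  hence f: "f \<in> Hom C Y W" and g: "g \<in> Hom C Y W" using HomD[OF e] by auto
  obtain d where d: "d \<in> Hom C Y W" "d \<oplus> g = f" using difference[OF f g] .
  have "d \<cdot> e \<oplus> g \<cdot> e = g \<cdot> e" using Add_Comp[OF e d(1) g] d(2) efg by simp
  hence "d = Null C Y W" using Add_cancel[OF Comp_Hom[OF e d(1)] Comp_Hom[OF e g]] null d by blast
  thus "f = g" using d Null_Add[OF g] by simp
qed

lemma mono_null:
  assumes "is_mono C m" "m \<in> Hom C X Y" "d \<in> Hom C W X" "m \<cdot> d = Null C W Y"
  shows "d = Null C W X"
  using monoD[OF assms(1-3), of "Null C W X"] assms Comp_Null[of m X Y W] Null_Hom Hom_Obj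
  by metis

lemma epi_null:
  assumes "is_epi C e" "e \<in> Hom C X Y" "d \<in> Hom C Y W" "d \<cdot> e = Null C X W"
  shows "d = Null C Y W"
  using epiD[OF assms(1-3), of "Null C Y W"] assms Null_Comp[of e X Y W] Null_Hom Hom_Obj
  by metis

text \<open>The uniqueness half of the universal property amounts to \<open>k\<close> being mono: by
  \<open>monoI\<close> only factorizations of zero have to be compared, and those are unique.
  Verifying a kernel thus splits into a mono test and bare existence of factorizations.\<close>

lemma is_kernel_iff:
  assumes k: "k \<in> Hom C X Y" and f: "f \<in> Hom C Y Z"
  shows "is_kernel C k f \<longleftrightarrow> is_mono C k \<and> f \<cdot> k = Null C X Z \<and>
    (\<forall>W. \<forall>h \<in> Hom C W Y. f \<cdot> h = Null C W Z \<longrightarrow> (\<exists>u \<in> Hom C W X. k \<cdot> u = h))"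
    (is "?L \<longleftrightarrow> ?R")
proof
  assume L: ?L
  have "is_mono C k"
  proof (rule monoI[OF k])
    fix W d assume d: "d \<in> Hom C W X" "k \<cdot> d = Null C W Y"
    have W: "W \<in> Obj C" using Hom_Obj[OF d(1)] by simp
    have "Null C W Y \<in> Hom C W Y" "f \<cdot> Null C W Y = Null C W Z"
      using Null_Hom W Hom_Obj[OF f] Comp_Null[OF f W] by auto
    hence "\<exists>!u. u \<in> Hom C W X \<and> k \<cdot> u = Null C W Y"
      using L HomD[OF k] HomD[OF f] unfolding is_kernel_def by auto
    thus "d = Null C W X"
      using d Null_Hom[OF W] Hom_Obj[OF k] Comp_Null[OF k W] by blast
  qed
  thus ?R using L HomD[OF k] HomD[OF f] unfolding is_kernel_def by clarsimp blast
next
  assume R: ?R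
  hence "\<And>u v W. \<lbrakk>u \<in> Hom C W X; v \<in> Hom C W X; k \<cdot> u = k \<cdot> v\<rbrakk> \<Longrightarrow> u = v"
    using monoD k by blast
  thus ?L using R HomD[OF k] HomD[OF f] unfolding is_kernel_def by metis
qed

lemma is_cokernel_iff:
  assumes q: "q \<in> Hom C Y Z" and f: "f \<in> Hom C X Y"
  shows "is_cokernel C q f \<longleftrightarrow> is_epi C q \<and> q \<cdot> f = Null C X Z \<and>
    (\<forall>W. \<forall>h \<in> Hom C Y W. h \<cdot> f = Null C X W \<longrightarrow> (\<exists>u \<in> Hom C Z W. u \<cdot> q = h))"
    (is "?L \<longleftrightarrow> ?R")
proof
  assume L: ?L
  have "is_epi C q"
  proof (rule epiI[OF q])
    fix W d assume d: "d \<in> Hom C Z W" "d \<cdot> q = Null C Y W"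
    have W: "W \<in> Obj C" using Hom_Obj[OF d(1)] by simp
    have "Null C Y W \<in> Hom C Y W" "Null C Y W \<cdot> f = Null C X W"
      using Null_Hom W Hom_Obj[OF f] Null_Comp[OF f W] by auto
    hence "\<exists>!u. u \<in> Hom C Z W \<and> u \<cdot> q = Null C Y W"
      using L HomD[OF q] HomD[OF f] unfolding is_cokernel_def by auto
    thus "d = Null C Z W"
      using d Null_Hom W Hom_Obj[OF q] Null_Comp[OF q W] by blast
  qed
  thus ?R using L HomD[OF q] HomD[OF f] unfolding is_cokernel_def by clarsimp blast
next
  assume R: ?R
  hence "\<And>u v W. \<lbrakk>u \<in> Hom C Z W; v \<in> Hom C Z W; u \<cdot> q = v \<cdot> q\<rbrakk> \<Longrightarrow> u = v"
    using epiD q by blast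
  thus ?L using R HomD[OF q] HomD[OF f] unfolding is_cokernel_def by metis
qed

lemma kernelE:
  assumes k: "is_kernel C k f" and f: "f \<in> Hom C Y Z"
  obtains X where "k \<in> Hom C X Y" "is_mono C k" "f \<cdot> k = Null C X Z"
    "\<And>W h. \<lbrakk>h \<in> Hom C W Y; f \<cdot> h = Null C W Z\<rbrakk> \<Longrightarrow> \<exists>u \<in> Hom C W X. k \<cdot> u = h"
proof -
  have "k \<in> Hom C (Dom C k) Y" using k HomD[OF f] unfolding is_kernel_def Hom_def by simp
  thus thesis using that[of "Dom C k"] is_kernel_iff[OF _ f] k by auto
qed

lemma cokernelE:
  assumes q: "is_cokernel C q f" and f: "f \<in> Hom C X Y"
  obtains Z where "q \<in> Hom C Y Z" "is_epi C q" "q \<cdot> f = Null C X Z"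
    "\<And>W h. \<lbrakk>h \<in> Hom C Y W; h \<cdot> f = Null C X W\<rbrakk> \<Longrightarrow> \<exists>u \<in> Hom C Z W. u \<cdot> q = h"
proof -
  have "q \<in> Hom C Y (Cod C q)" using q HomD[OF f] unfolding is_cokernel_def Hom_def by simp
  thus thesis using that[of "Cod C q"] is_cokernel_iff[OF _ f] q by auto
qed

text \<open>If the identity of \<open>Z\<close> vanishes, so does every morphism into or out of
  \<open>Z\<close>. In this equational form being zero passes through additive functors and can be
  reached by \<open>mono_null\<close> and \<open>epi_null\<close>.\<close>

lemma zero_object_iff:
  assumes Z: "Z \<in> Obj C"
  shows "is_zero_object C Z \<longleftrightarrow> Ide C Z = Null C Z Z"
proof
  assume "is_zero_object C Z"
  thus "Ide C Z = Null C Z Z"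
    using Z Ide_Hom Null_Hom unfolding is_zero_object_def by blast
next
  assume I: "Ide C Z = Null C Z Z"
  have "f = Null C Z X" if "f \<in> Hom C Z X" for f X
    using Comp_Ide[OF that] Comp_Null[OF that Z] I by simp
  moreover have "f = Null C X Z" if "f \<in> Hom C X Z" for f X
    using Ide_Comp[OF that] Null_Comp[OF that Z] I by simp
  ultimately show "is_zero_object C Z"
    using Z Null_Hom unfolding is_zero_object_def by metis
qed

lemma zero_object_Hom:
  assumes "is_zero_object C Z"
  shows "f \<in> Hom C Z X \<Longrightarrow> f = Null C Z X" "f \<in> Hom C X Z \<Longrightarrow> f = Null C X Z"
  using assms Null_Hom Hom_Obj unfolding is_zero_object_def by metis+

end

section \<open>Normality and image factorization\<close>

context abelian_category
begin

lemma kernel: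
  assumes "f \<in> Hom C X Y"
  obtains K k where "is_kernel C k f" "k \<in> Hom C K X"
  using has_kernels[of f] HomD[OF assms] kernelE[OF _ assms] by metis

lemma cokernel:
  assumes "f \<in> Hom C X Y"
  obtains Q q where "is_cokernel C q f" "q \<in> Hom C Y Q"
  using has_cokernels[of f] HomD[OF assms] cokernelE[OF _ assms] by metis

text \<open>By normality \<open>m\<close> is the kernel of some \<open>f\<close>. This
  \<open>f\<close> factors through the cokernel \<open>q\<close>, so whatever \<open>q\<close> kills
  is killed by \<open>f\<close> and hence factors through \<open>m\<close>.\<close>

lemma mono_kernel_of_cokernel:
  assumes m: "is_mono C m" "m \<in> Hom C X Y" and q: "is_cokernel C q m"
  shows "is_kernel C m q"
proof -
  obtain Z where q': "q \<in> Hom C Y Z" "q \<cdot> m = Null C X Z"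
    "\<And>W h. \<lbrakk>h \<in> Hom C Y W; h \<cdot> m = Null C X W\<rbrakk> \<Longrightarrow> \<exists>u \<in> Hom C Z W. u \<cdot> q = h"
    using cokernelE[OF q m(2)] by metis
  obtain f where f: "is_kernel C m f" using mono_normal m by blast
  define W where "W = Cod C f"
  have fH: "f \<in> Hom C Y W" using f HomD[OF m(2)] unfolding is_kernel_def W_def Hom_def by auto
  note F = is_kernel_iff[OF m(2) fH, THEN iffD1, OF f]
  obtain u where u: "u \<in> Hom C Z W" "u \<cdot> q = f" using q'(3) fH F by blast
  have "\<exists>v \<in> Hom C V X. m \<cdot> v = h" if h: "h \<in> Hom C V Y" "q \<cdot> h = Null C V Z" for V h
  proof -
    have "f \<cdot> h = u \<cdot> (q \<cdot> h)" using Comp_assoc[OF h(1) q'(1) u(1)] u by simp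
    also have "\<dots> = Null C V W" using h(2) Comp_Null[OF u(1)] Hom_Obj[OF h(1)] by simp
    finally show ?thesis using F h by blast
  qed
  thus ?thesis using is_kernel_iff[OF m(2) q'(1)] m q' by blast
qed

lemma epi_cokernel_of_kernel:
  assumes e: "is_epi C e" "e \<in> Hom C X Y" and k: "is_kernel C k e"
  shows "is_cokernel C e k"
proof -
  obtain K where k': "k \<in> Hom C K X" "e \<cdot> k = Null C K Y"
    "\<And>W h. \<lbrakk>h \<in> Hom C W X; e \<cdot> h = Null C W Y\<rbrakk> \<Longrightarrow> \<exists>u \<in> Hom C W K. k \<cdot> u = h"
    using kernelE[OF k e(2)] by metis
  obtain f where f: "is_cokernel C e f" using epi_normal e by blast
  define W where "W = Dom C f"
  have fH: "f \<in> Hom C W X" using f HomD[OF e(2)] unfolding is_cokernel_def W_def Hom_def by auto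
  note F = is_cokernel_iff[OF e(2) fH, THEN iffD1, OF f]
  obtain u where u: "u \<in> Hom C W K" "k \<cdot> u = f" using k'(3) fH F by blast
  have "\<exists>v \<in> Hom C Y V. v \<cdot> e = h" if h: "h \<in> Hom C X V" "h \<cdot> k = Null C K V" for V h
  proof -
    have "h \<cdot> f = (h \<cdot> k) \<cdot> u" using Comp_assoc[OF u(1) k'(1) h(1)] u by simp
    also have "\<dots> = Null C W V" using h(2) Null_Comp[OF u(1)] Hom_Obj[OF h(1)] by simp
    finally show ?thesis using F h by blast
  qed
  thus ?thesis using is_cokernel_iff[OF e(2) k'(1)] e k' by blast
qed

text \<open>Given \<open>x\<close> with \<open>m \<cdot> x\<close> zero, pass to the cokernel
  \<open>q\<close> of \<open>x\<close>. Since \<open>m\<close> factors through \<open>q\<close>, the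
  kernel of \<open>q \<cdot> e\<close> lies in that of \<open>f\<close>, so \<open>e\<close> kills
  it and factors through \<open>q \<cdot> e\<close>. This makes \<open>q\<close> a split mono, and
  \<open>q \<cdot> x\<close> being zero forces \<open>x\<close> to be zero.\<close>

lemma coimage_mono:
  assumes f: "f \<in> Hom C X Y" and k: "is_kernel C k f" and e: "is_cokernel C e k" "e \<in> Hom C X I"
    and m: "m \<in> Hom C I Y" and me: "m \<cdot> e = f"
  shows "is_mono C m"
proof (rule monoI[OF m])
  fix W x assume x: "x \<in> Hom C W I" "m \<cdot> x = Null C W Y"
  obtain K where k': "k \<in> Hom C K X" "f \<cdot> k = Null C K Y"
    "\<And>W h. \<lbrakk>h \<in> Hom C W X; f \<cdot> h = Null C W Y\<rbrakk> \<Longrightarrow> \<exists>u \<in> Hom C W K. k \<cdot> u = h"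
    using kernelE[OF k f] by metis
  note E = is_cokernel_iff[OF e(2) k'(1), THEN iffD1, OF e(1)]
  obtain Q q where q: "is_cokernel C q x" "q \<in> Hom C I Q" using cokernel[OF x(1)] .
  note q' = is_cokernel_iff[OF q(2) x(1), THEN iffD1, OF q(1)]
  obtain m' where m': "m' \<in> Hom C Q Y" "m' \<cdot> q = m" using q' m x by blast
  have qe: "is_epi C (q \<cdot> e)" "q \<cdot> e \<in> Hom C X Q"
    using epi_comp e(2) E q q' Comp_Hom by blast+
  obtain H h where h: "is_kernel C h (q \<cdot> e)" "h \<in> Hom C H X" using kernel[OF qe(2)] .
  have "f \<cdot> h = m' \<cdot> ((q \<cdot> e) \<cdot> h)"
    using me m' Comp_assoc[OF e(2) q(2) m'(1)] Comp_assoc[OF h(2) qe(2) m'(1)] by simp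
  also have "\<dots> = Null C H Y"
    using is_kernel_iff[OF h(2) qe(2)] h Comp_Null[OF m'(1)] Hom_Obj[OF h(2)] by simp
  finally obtain u where u: "u \<in> Hom C H K" "k \<cdot> u = h" using k' h by blast
  have "e \<cdot> h = (e \<cdot> k) \<cdot> u" using u Comp_assoc[OF u(1) k'(1) e(2)] by simp
  also have "\<dots> = Null C H I" using E Null_Comp[OF u(1)] Hom_Obj[OF e(2)] by simp
  finally have eh: "e \<cdot> h = Null C H I" .
  have "is_cokernel C (q \<cdot> e) h" using epi_cokernel_of_kernel[OF qe h(1)] .
  then obtain t where t: "t \<in> Hom C Q I" "t \<cdot> (q \<cdot> e) = e"
    using is_cokernel_iff[OF qe(2) h(2)] e(2) eh by blast
  have "(t \<cdot> q) \<cdot> e = Ide C I \<cdot> e" using t Comp_assoc[OF e(2) q(2) t(1)] Ide_Comp[OF e(2)] by simp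
  hence "t \<cdot> q = Ide C I"
    using epiD[OF _ e(2) Comp_Hom[OF q(2) t(1)] Ide_Hom] E Hom_Obj[OF e(2)] by blast
  hence "is_mono C q" using split_mono q t by blast
  thus "x = Null C W I" using mono_null q(2) x(1) q' by blast
qed

text \<open>The image is built as the cokernel of the kernel, so its epi part is a cokernel of the
  given \<open>k\<close>. Applied to a left exact image of a short exact sequence, this locates the
  cokernel of the first arrow as a subobject of the third term.\<close>

lemma image_factorization:
  assumes f: "f \<in> Hom C X Y" and k: "is_kernel C k f"
  obtains I e m where "e \<in> Hom C X I" "m \<in> Hom C I Y" "is_epi C e" "is_mono C m" "m \<cdot> e = f"
    "short_exact C k e"
proof -
  obtain K where k': "k \<in> Hom C K X" "is_mono C k" "f \<cdot> k = Null C K Y"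
    "\<And>W h. \<lbrakk>h \<in> Hom C W X; f \<cdot> h = Null C W Y\<rbrakk> \<Longrightarrow> \<exists>u \<in> Hom C W K. k \<cdot> u = h"
    using kernelE[OF k f] by metis
  obtain I e where e: "is_cokernel C e k" "e \<in> Hom C X I" using cokernel[OF k'(1)] .
  note E = is_cokernel_iff[OF e(2) k'(1), THEN iffD1, OF e(1)]
  obtain m where m: "m \<in> Hom C I Y" "m \<cdot> e = f" using E f k' by blast
  have "is_mono C m" using coimage_mono[OF f k e m] .
  moreover have "is_kernel C k e" using mono_kernel_of_cokernel[OF k'(2,1) e(1)] .
  ultimately show thesis using that e m E unfolding short_exact_def by blast
qed

lemma image:
  assumes f: "f \<in> Hom C X Y"
  obtains I e m where "e \<in> Hom C X I" "m \<in> Hom C I Y" "is_epi C e" "is_mono C m" "m \<cdot> e = f"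
  using kernel[OF f] image_factorization[OF f] by metis

text \<open>The mono \<open>m'\<close> is the kernel of its cokernel \<open>q\<close>, and
  \<open>q\<close> kills \<open>m\<close> because it kills \<open>m \<cdot> e\<close> and
  \<open>e\<close> is epi. This compares the images of two morphisms when one factors through the
  other.\<close>

lemma image_mono:
  assumes e: "is_epi C e" "e \<in> Hom C X I" and m: "m \<in> Hom C I Y"
    and e': "e' \<in> Hom C X' I'" and m': "is_mono C m'" "m' \<in> Hom C I' Y"
    and t: "t \<in> Hom C X X'" and eq: "m \<cdot> e = (m' \<cdot> e') \<cdot> t"
  obtains u where "u \<in> Hom C I I'" "m' \<cdot> u = m"
proof -
  obtain Q q where q: "is_cokernel C q m'" "q \<in> Hom C Y Q" using cokernel[OF m'(2)] .
  note q' = is_cokernel_iff[OF q(2) m'(2), THEN iffD1, OF q(1)]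
  have k: "is_kernel C m' q" using mono_kernel_of_cokernel[OF m' q(1)] .
  have e't: "e' \<cdot> t \<in> Hom C X I'" using Comp_Hom t e' by blast
  have "(q \<cdot> m) \<cdot> e = q \<cdot> (m' \<cdot> (e' \<cdot> t))"
    using eq Comp_assoc[OF e(2) m q(2)] Comp_assoc[OF t e' m'(2)] by simp
  also have "\<dots> = Null C X Q"
    using Comp_assoc[OF e't m'(2) q(2)] q' Null_Comp[OF e't] Hom_Obj[OF q(2)] by simp
  finally have "q \<cdot> m = Null C I Q" using epi_null[OF e Comp_Hom[OF m q(2)]] by blast
  thus thesis using that is_kernel_iff[OF m'(2) q(2)] k m by blast
qed

end

section \<open>Direct limits in Grothendieck categories\<close>

lemma small_mono: "\<lbrakk>small U S; T \<subseteq> S\<rbrakk> \<Longrightarrow> small U T"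
  unfolding small_def by (rule ordLeq_ordLess_trans[OF card_of_mono1])

lemma (in category) coproduct_eqI:
  assumes S: "is_coproduct C I X S \<iota>" and h: "h \<in> Hom C S Y" "h' \<in> Hom C S Y"
    and eq: "\<And>i. i \<in> I \<Longrightarrow> h \<cdot> \<iota> i = h' \<cdot> \<iota> i"
  shows "h = h'"
proof -
  have "\<forall>i\<in>I. h' \<cdot> \<iota> i \<in> Hom C (X i) Y"
    using S h Comp_Hom unfolding is_coproduct_def by blast
  hence "\<exists>!g. g \<in> Hom C S Y \<and> (\<forall>i\<in>I. g \<cdot> \<iota> i = h' \<cdot> \<iota> i)"
    using S Hom_Obj(2)[OF h(1)] unfolding is_coproduct_def
    by (elim conjE ballE[of _ _ Y] allE[of _ "\<lambda>i. h' \<cdot> \<iota> i"] impE) auto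
  thus ?thesis using h eq by blast
qed

lemma coproduct_Obj: "is_coproduct C I X S \<iota> \<Longrightarrow> S \<in> Obj C"
  unfolding is_coproduct_def by (rule conjunct1)

lemma coproduct_inj: "\<lbrakk>is_coproduct C I X S \<iota>; i \<in> I\<rbrakk> \<Longrightarrow> \<iota> i \<in> Hom C (X i) S"
  unfolding is_coproduct_def by blast

lemma coproduct_desc:
  assumes "is_coproduct C I X S \<iota>" "Y \<in> Obj C" "\<forall>i\<in>I. f i \<in> Hom C (X i) Y"
  obtains h where "h \<in> Hom C S Y" "\<forall>i\<in>I. h \<cdot>\<^bsub>C\<^esub> \<iota> i = f i"
  using assms unfolding is_coproduct_def by metis

lemma (in preadditive_category) empty_coproduct_iff:
  "is_coproduct C {} X S \<iota> \<longleftrightarrow> is_zero_object C S"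
proof
  assume S: "is_coproduct C {} X S \<iota>"
  hence "S \<in> Obj C" unfolding is_coproduct_def by simp
  thus "is_zero_object C S"
    using zero_object_iff coproduct_eqI[OF S, of "Ide C S" S "Null C S S"] Ide_Hom Null_Hom by simp
next
  assume "is_zero_object C S"
  thus "is_coproduct C {} X S \<iota>"
    unfolding is_zero_object_def is_coproduct_def by simp
qed

section \<open>Membership in a localizing subcategory\<close>

context abelian_category
begin

lemma localizing_subobject:
  assumes "localizing_subcategory U C T" "is_mono C m" "m \<in> Hom C X Y" "Y \<in> T"
  shows "X \<in> T"
  using assms HomD unfolding localizing_subcategory_def closed_subcategory_def by blast

lemma localizing_quotient:
  assumes "localizing_subcategory U C T" "is_epi C e" "e \<in> Hom C X Y" "X \<in> T"
  shows "Y \<in> T"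
  using assms HomD unfolding localizing_subcategory_def closed_subcategory_def by blast

text \<open>The zero object enters \<open>T\<close> as the coproduct of the empty family.\<close>

lemma localizing_zero_object:
  fixes U :: "'u itself"
  assumes "universe U" and T: "localizing_subcategory U C T" and Z: "is_zero_object C Z"
  shows "Z \<in> T"
proof -
  have "small U ({} :: 'u set)"
    using assms(1) finite_ordLess_infinite[OF card_of_Well_order card_of_Well_order, of "{} :: 'u set" "UNIV :: 'u set"]
    unfolding universe_def small_def by (simp add: Field_card_of)
  thus ?thesis
    using T empty_coproduct_iff Z
    unfolding localizing_subcategory_def closed_subcategory_def by blast
qed

text \<open>Replacing \<open>Z\<close> by the image of \<open>f\<close>, which is a subobject of
  \<open>Z\<close>, turns the left exact sequence into a short exact one. Left exact functors
  produce only the former, while closure under extensions speaks of the latter.\<close>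

lemma localizing_left_exact:
  assumes T: "localizing_subcategory U C T" and k: "is_kernel C k f" "k \<in> Hom C X Y"
    and f: "f \<in> Hom C Y Z" and XZ: "X \<in> T" "Z \<in> T"
  shows "Y \<in> T"
proof -
  obtain I e m where e: "e \<in> Hom C Y I" "short_exact C k e"
    and m: "m \<in> Hom C I Z" "is_mono C m"
    using image_factorization[OF f k(1)] by metis
  have "I \<in> T" using localizing_subobject[OF T m(2,1) XZ(2)] .
  thus ?thesis
    using T e(2) HomD[OF e(1)] HomD[OF k(2)] XZ(1) unfolding localizing_subcategory_def by metis
qed

end

section \<open>Existence of direct limits, and directed unions\<close>

context grothendieck_category
begin

text \<open>The usual presentation: the limit is the cokernel of \<open>v\<close>, a map into the
  coproduct \<open>P\<close> of all \<open>X a\<close> whose components are the differences of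
  \<open>l b \<cdot> \<phi> a b\<close> and \<open>l a\<close>.\<close>

lemma direct_limit_exists:
  fixes I :: "'u set"
  assumes I: "small U I" and X: "directed_system C I r X \<phi>"
  obtains L l where "is_direct_limit C I r X \<phi> L l"
proof -
  have r: "r \<subseteq> I \<times> I"
    and X_Obj: "\<And>a. a \<in> I \<Longrightarrow> X a \<in> Obj C"
    and \<phi>: "\<And>a b. (a, b) \<in> r \<Longrightarrow> \<phi> a b \<in> Hom C (X a) (X b)"
    using X unfolding directed_system_def directed_set_def preorder_on_def by auto
  obtain P l where P: "is_coproduct C I X P l" using has_coproducts I X_Obj by metis
  have PO: "P \<in> Obj C" and l: "\<And>a. a \<in> I \<Longrightarrow> l a \<in> Hom C (X a) P"
    using coproduct_Obj[OF P] coproduct_inj[OF P] by auto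
  \<comment> \<open>The relations are indexed by pairs in \<open>r\<close>, but coproducts are
    available only over subsets of \<open>'u\<close>. Hence an iterated coproduct: for each
    \<open>a\<close> one copy of \<open>X a\<close> for every \<open>b\<close> above it, and then
    the coproduct over \<open>a\<close>.\<close>
  define up where "up a = {b. (a, b) \<in> r}" for a
  have "\<exists>R \<kappa>. is_coproduct C (up a) (\<lambda>_. X a) R \<kappa>" if "a \<in> I" for a
    by (rule has_coproducts) (use that r X_Obj small_mono[OF I, of "up a"] in \<open>auto simp: up_def\<close>)
  hence "\<forall>a\<in>I. \<exists>R \<kappa>. is_coproduct C (up a) (\<lambda>_. X a) R \<kappa>" by blast
  from bchoice[OF this] obtain R where "\<forall>a\<in>I. \<exists>\<kappa>. is_coproduct C (up a) (\<lambda>_. X a) (R a) \<kappa>" ..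
  from bchoice[OF this] obtain \<kappa>
    where R: "\<And>a. a \<in> I \<Longrightarrow> is_coproduct C (up a) (\<lambda>_. X a) (R a) (\<kappa> a)" by blast
  have RO: "\<And>a. a \<in> I \<Longrightarrow> R a \<in> Obj C"
    and \<kappa>: "\<And>a b. (a, b) \<in> r \<Longrightarrow> \<kappa> a b \<in> Hom C (X a) (R a)"
    using coproduct_Obj[OF R] coproduct_inj[OF R] r unfolding up_def by auto
  have "\<exists>d. d \<in> Hom C (X a) P \<and> d \<oplus> l a = l b \<cdot> \<phi> a b" if "(a, b) \<in> r" for a b
  proof -
    have "l b \<cdot> \<phi> a b \<in> Hom C (X a) P" "l a \<in> Hom C (X a) P"
      using Comp_Hom[OF \<phi>[OF that] l] l that r by auto
    thus ?thesis by (metis difference)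
  qed
  then obtain d where d: "\<And>a b. (a, b) \<in> r \<Longrightarrow> d a b \<in> Hom C (X a) P"
    "\<And>a b. (a, b) \<in> r \<Longrightarrow> d a b \<oplus> l a = l b \<cdot> \<phi> a b"
    by metis
  have "\<exists>w. w \<in> Hom C (R a) P \<and> (\<forall>b\<in>up a. w \<cdot> \<kappa> a b = d a b)" if "a \<in> I" for a
  proof -
    have "\<forall>b\<in>up a. d a b \<in> Hom C (X a) P" using d(1) unfolding up_def by simp
    thus ?thesis by (rule coproduct_desc[OF R[OF that] PO]) blast
  qed
  then obtain w where w: "\<And>a. a \<in> I \<Longrightarrow> w a \<in> Hom C (R a) P"
    "\<And>a b. (a, b) \<in> r \<Longrightarrow> w a \<cdot> \<kappa> a b = d a b"
  proof -
    assume *: "\<And>w. \<lbrakk>\<And>a. a \<in> I \<Longrightarrow> w a \<in> Hom C (R a) P; \<And>a b. (a, b) \<in> r \<Longrightarrow> w a \<cdot> \<kappa> a b = d a b\<rbrakk> \<Longrightarrow> thesis"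
    assume "\<And>a. a \<in> I \<Longrightarrow> \<exists>w. w \<in> Hom C (R a) P \<and> (\<forall>b\<in>up a. w \<cdot> \<kappa> a b = d a b)"
    hence "\<forall>a\<in>I. \<exists>w. w \<in> Hom C (R a) P \<and> (\<forall>b\<in>up a. w \<cdot> \<kappa> a b = d a b)" by blast
    from bchoice[OF this] obtain w
      where w: "\<forall>a\<in>I. w a \<in> Hom C (R a) P \<and> (\<forall>b\<in>up a. w a \<cdot> \<kappa> a b = d a b)" ..
    show thesis by (rule *[of w]) (use w r in \<open>auto simp: up_def\<close>)
  qed
  obtain S \<sigma> where S: "is_coproduct C I R S \<sigma>" using has_coproducts I RO by metis
  have SO: "S \<in> Obj C" and \<sigma>: "\<And>a. a \<in> I \<Longrightarrow> \<sigma> a \<in> Hom C (R a) S"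
    using coproduct_Obj[OF S] coproduct_inj[OF S] by auto
  obtain v where v: "v \<in> Hom C S P" "\<And>a. a \<in> I \<Longrightarrow> v \<cdot> \<sigma> a = w a"
    using coproduct_desc[OF S PO, of w] w by metis
  \<comment> \<open>The morphisms out of \<open>P\<close> that kill \<open>v\<close> are exactly
    those whose components form a cocone, so the universal property of the cokernel becomes that of
    the direct limit.\<close>
  have v_null: "h \<cdot> v = Null C S Y \<longleftrightarrow> (\<forall>(a, b)\<in>r. (h \<cdot> l b) \<cdot> \<phi> a b = h \<cdot> l a)"
    if h: "h \<in> Hom C P Y" for h Y
  proof -
    have YO: "Y \<in> Obj C" using Hom_Obj[OF h] by simp
    have hv: "(h \<cdot> v) \<cdot> \<sigma> a \<cdot> \<kappa> a b = h \<cdot> d a b" if ab: "(a, b) \<in> r" for a b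
    proof -
      have a: "a \<in> I" using ab r by auto
      show ?thesis
        using Comp_assoc[OF \<kappa>[OF ab] \<sigma>[OF a] Comp_Hom[OF v(1) h]] Comp_assoc[OF \<sigma>[OF a] v(1) h]
          Comp_assoc[OF \<kappa>[OF ab] w(1)[OF a] h] v(2)[OF a] w(2)[OF ab] by simp
    qed
    have hd: "(h \<cdot> l b) \<cdot> \<phi> a b = h \<cdot> d a b \<oplus> h \<cdot> l a" if ab: "(a, b) \<in> r" for a b
    proof -
      have a: "a \<in> I" and b: "b \<in> I" using ab r by auto
      show ?thesis
        using Comp_assoc[OF \<phi>[OF ab] l[OF b] h] Comp_Add[OF d(1)[OF ab] l[OF a] h] d(2)[OF ab] by simp
    qed
    have hl: "h \<cdot> d a b \<in> Hom C (X a) Y" "h \<cdot> l a \<in> Hom C (X a) Y" if "(a, b) \<in> r" for a b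
      using Comp_Hom d(1)[OF that] l[of a] h that r by auto
    show ?thesis
    proof
      assume hv0: "h \<cdot> v = Null C S Y"
      have "(h \<cdot> l b) \<cdot> \<phi> a b = h \<cdot> l a" if ab: "(a, b) \<in> r" for a b
      proof -
        have a: "a \<in> I" using ab r by auto
        have "h \<cdot> d a b = Null C (X a) Y"
          using hv[OF ab] hv0 Null_Comp[OF \<sigma>[OF a] YO] Null_Comp[OF \<kappa>[OF ab] YO] by simp
        thus ?thesis using hd[OF ab] Null_Add hl[OF ab] by simp
      qed
      thus "\<forall>(a, b)\<in>r. (h \<cdot> l b) \<cdot> \<phi> a b = h \<cdot> l a" by auto
    next
      assume eq: "\<forall>(a, b)\<in>r. (h \<cdot> l b) \<cdot> \<phi> a b = h \<cdot> l a"
      show "h \<cdot> v = Null C S Y"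
      proof (rule coproduct_eqI[OF S Comp_Hom[OF v(1) h] Null_Hom[OF SO YO]])
        fix a assume a: "a \<in> I"
        show "h \<cdot> v \<cdot> \<sigma> a = Null C S Y \<cdot> \<sigma> a"
        proof (rule coproduct_eqI[OF R[OF a]])
          show "h \<cdot> v \<cdot> \<sigma> a \<in> Hom C (R a) Y" using Comp_Hom v(1) h \<sigma>[OF a] by blast
          show "Null C S Y \<cdot> \<sigma> a \<in> Hom C (R a) Y" using Comp_Hom Null_Hom[OF SO YO] \<sigma>[OF a] by blast
          fix b assume "b \<in> up a"
          hence ab: "(a, b) \<in> r" by (simp add: up_def)
          have "h \<cdot> d a b = Null C (X a) Y"
            using Add_cancel[OF hl[OF ab]] hd[OF ab] eq ab by auto
          thus "h \<cdot> v \<cdot> \<sigma> a \<cdot> \<kappa> a b = Null C S Y \<cdot> \<sigma> a \<cdot> \<kappa> a b"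
            using hv[OF ab] Null_Comp[OF \<sigma>[OF a] YO] Null_Comp[OF \<kappa>[OF ab] YO] by simp
        qed
      qed
    qed
  qed
  obtain L q where q: "is_cokernel C q v" "q \<in> Hom C P L" using cokernel[OF v(1)] .
  note q' = is_cokernel_iff[OF q(2) v(1), THEN iffD1, OF q(1)]
  have cocone: "is_cocone C I r X \<phi> L (\<lambda>a. q \<cdot> l a)"
    using q' v_null[OF q(2)] Comp_Hom[OF l q(2)] Hom_Obj[OF q(2)] unfolding is_cocone_def by auto
  have "\<exists>!h. h \<in> Hom C L Y \<and> (\<forall>i\<in>I. h \<cdot> (q \<cdot> l i) = c i)" if c: "is_cocone C I r X \<phi> Y c" for Y c
  proof -
    have YO: "Y \<in> Obj C" and cH: "\<forall>a\<in>I. c a \<in> Hom C (X a) Y"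
      and c\<phi>: "\<And>a b. (a, b) \<in> r \<Longrightarrow> c b \<cdot> \<phi> a b = c a"
      using c unfolding is_cocone_def by auto
    obtain h where h: "h \<in> Hom C P Y" "\<forall>a\<in>I. h \<cdot> l a = c a" using coproduct_desc[OF P YO cH] .
    have "h \<cdot> v = Null C S Y" using v_null[OF h(1)] h(2) c\<phi> r by auto
    then obtain u where u: "u \<in> Hom C L Y" "u \<cdot> q = h" using q' h by blast
    show ?thesis
    proof (rule ex1I[of _ u])
      show "u \<in> Hom C L Y \<and> (\<forall>i\<in>I. u \<cdot> (q \<cdot> l i) = c i)"
        using u h Comp_assoc[OF l q(2) u(1)] by auto
      fix u' assume u': "u' \<in> Hom C L Y \<and> (\<forall>i\<in>I. u' \<cdot> (q \<cdot> l i) = c i)"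
      have "u' \<cdot> q = h"
        by (rule coproduct_eqI[OF P _ h(1)])
          (use u' h(2) Comp_Hom[OF q(2)] Comp_assoc[OF l q(2), of _ u' Y] in auto)
      thus "u' = u" using epiD[OF _ q(2), of u' Y u] q' u u' by metis
    qed
  qed
  thus thesis using that X cocone unfolding is_direct_limit_def by blast
qed

text \<open>A direct limit is a quotient of the coproduct of its terms; the uniqueness part of its
  universal property is what makes the canonical \<open>p\<close> an epimorphism.\<close>

lemma localizing_direct_limit:
  fixes I :: "'u set"
  assumes T: "localizing_subcategory U C T" and I: "small U I"
    and L: "is_direct_limit C I r X \<phi> L l" and XT: "\<forall>i\<in>I. X i \<in> T"
  shows "L \<in> T"
proof -
  have cocone: "is_cocone C I r X \<phi> L l"
    and univ: "\<And>Y c. is_cocone C I r X \<phi> Y c \<Longrightarrow> \<exists>!h. h \<in> Hom C L Y \<and> (\<forall>i\<in>I. h \<cdot> l i = c i)"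
    and X: "directed_system C I r X \<phi>"
    using L unfolding is_direct_limit_def by auto
  have r: "r \<subseteq> I \<times> I"
    and \<phi>: "\<And>a b. (a, b) \<in> r \<Longrightarrow> \<phi> a b \<in> Hom C (X a) (X b)"
    using X unfolding directed_system_def directed_set_def preorder_on_def by auto
  have LO: "L \<in> Obj C" and l: "\<forall>i\<in>I. l i \<in> Hom C (X i) L"
    using cocone unfolding is_cocone_def by auto
  have "\<forall>i\<in>I. X i \<in> Obj C" using X unfolding directed_system_def by blast
  then obtain P \<iota> where P: "is_coproduct C I X P \<iota>" using has_coproducts I by metis
  have \<iota>: "\<And>i. i \<in> I \<Longrightarrow> \<iota> i \<in> Hom C (X i) P" using coproduct_inj[OF P] .
  obtain p where p: "p \<in> Hom C P L" "\<forall>i\<in>I. p \<cdot> \<iota> i = l i" using coproduct_desc[OF P LO l] .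
  have "is_epi C p"
  proof (rule epiI[OF p(1)])
    fix W d assume d: "d \<in> Hom C L W" "d \<cdot> p = Null C P W"
    have WO: "W \<in> Obj C" using Hom_Obj[OF d(1)] by simp
    \<comment> \<open>Both \<open>d\<close> and the zero morphism induce the zero cocone, so they
      agree.\<close>
    let ?c = "\<lambda>i. Null C (X i) W"
    have dl: "d \<cdot> l i = ?c i" if "i \<in> I" for i
      using Comp_assoc[OF \<iota>[OF that] p(1) d(1)] d(2) Null_Comp[OF \<iota>[OF that] WO] p(2) that by simp
    moreover have "Null C L W \<cdot> l i = ?c i" if "i \<in> I" for i
      using Null_Comp[OF _ WO] l that by blast
    moreover have "is_cocone C I r X \<phi> W ?c"
      using WO Null_Hom Null_Comp[OF \<phi> WO] X unfolding is_cocone_def directed_system_def by auto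
    ultimately show "d = Null C L W" using univ[of W ?c] d(1) Null_Hom[OF LO WO] by blast
  qed
  moreover have "P \<in> T"
    using T P I XT unfolding localizing_subcategory_def closed_subcategory_def by blast
  ultimately show ?thesis using localizing_quotient[OF T _ p(1)] by blast
qed

text \<open>Exactness is applied to the sequences \<open>0 -> X i -> Q -> Z i -> 0\<close> with
  constant middle term. By \<open>union\<close> the cokernels \<open>Z i\<close> have limit zero, so
  the canonical \<open>f\<close> from the limit of the \<open>X i\<close> to \<open>Q\<close> is a
  kernel of a zero morphism, that is, an isomorphism.\<close>

lemma directed_union:
  fixes I :: "'u set"
  assumes I: "small U I" and X: "directed_system C I r X \<phi>" and QO: "Q \<in> Obj C"
    and m: "\<And>i. i \<in> I \<Longrightarrow> m i \<in> Hom C (X i) Q" "\<And>i. i \<in> I \<Longrightarrow> is_mono C (m i)"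
    and m\<phi>: "\<And>i j. (i, j) \<in> r \<Longrightarrow> m j \<cdot> \<phi> i j = m i"
    and union: "\<And>Y h. \<lbrakk>h \<in> Hom C Q Y; \<forall>i\<in>I. h \<cdot> m i = Null C (X i) Y\<rbrakk> \<Longrightarrow> h = Null C Q Y"
  shows "is_direct_limit C I r X \<phi> Q m"
proof -
  have r: "r \<subseteq> I \<times> I" and refl: "\<And>i. i \<in> I \<Longrightarrow> (i, i) \<in> r" and trans: "trans r" and ne: "I \<noteq> {}"
    and dir: "\<And>i j. \<lbrakk>i \<in> I; j \<in> I\<rbrakk> \<Longrightarrow> \<exists>k\<in>I. (i, k) \<in> r \<and> (j, k) \<in> r"
    and I_dir: "directed_set I r"
    and \<phi>: "\<And>a b. (a, b) \<in> r \<Longrightarrow> \<phi> a b \<in> Hom C (X a) (X b)"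
    and \<phi>_id: "\<And>i. i \<in> I \<Longrightarrow> \<phi> i i = Ide C (X i)"
    using X unfolding directed_system_def directed_set_def preorder_on_def refl_on_def by auto
  obtain i0 where i0: "i0 \<in> I" using ne by blast
  obtain L l where L: "is_direct_limit C I r X \<phi> L l" using direct_limit_exists[OF I X] .
  have univ: "\<And>Y c. is_cocone C I r X \<phi> Y c \<Longrightarrow> \<exists>!h. h \<in> Hom C L Y \<and> (\<forall>i\<in>I. h \<cdot> l i = c i)"
    and l: "\<And>i. i \<in> I \<Longrightarrow> l i \<in> Hom C (X i) L"
    using L unfolding is_direct_limit_def is_cocone_def by auto
  have m_cocone: "is_cocone C I r X \<phi> Q m" using QO m m\<phi> unfolding is_cocone_def by auto
  obtain f where f: "f \<in> Hom C L Q" "\<And>i. i \<in> I \<Longrightarrow> f \<cdot> l i = m i"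
    using univ[OF m_cocone] by blast
  have "\<exists>Z v. is_cokernel C v (m i) \<and> v \<in> Hom C Q Z" if "i \<in> I" for i
    using cokernel[OF m(1)[OF that]] by metis
  then obtain Z v where v: "\<And>i. i \<in> I \<Longrightarrow> is_cokernel C (v i) (m i)"
    "\<And>i. i \<in> I \<Longrightarrow> v i \<in> Hom C Q (Z i)"
    by metis
  note v' = is_cokernel_iff[OF v(2) m(1), THEN iffD1, OF _ _ v(1)]
  have exact: "short_exact C (m i) (v i)" if "i \<in> I" for i
    using mono_kernel_of_cokernel[OF m(2)[OF that] m(1)[OF that] v(1)[OF that]] v(1)[OF that]
    unfolding short_exact_def by blast
  have "\<exists>x. x \<in> Hom C (Z i) (Z j) \<and> x \<cdot> v i = v j" if "(i, j) \<in> r" for i j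
  proof -
    have i: "i \<in> I" and j: "j \<in> I" using that r by auto
    have "v j \<cdot> m i = (v j \<cdot> m j) \<cdot> \<phi> i j"
      using Comp_assoc[OF \<phi>[OF that] m(1)[OF j] v(2)[OF j]] m\<phi>[OF that] by simp
    also have "\<dots> = Null C (X i) (Z j)"
      using v'[OF j j j] Null_Comp[OF \<phi>[OF that]] Hom_Obj[OF v(2)[OF j]] by simp
    finally show ?thesis using v'[OF i i i] v(2)[OF j] by blast
  qed
  then obtain \<chi> where \<chi>: "\<And>i j. (i, j) \<in> r \<Longrightarrow> \<chi> i j \<in> Hom C (Z i) (Z j)"
    "\<And>i j. (i, j) \<in> r \<Longrightarrow> \<chi> i j \<cdot> v i = v j"
    by metis
  \<comment> \<open>The maps \<open>\<chi> i j\<close> come out of a choice; on the diagonal they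
    are replaced by the identities that \<open>directed_system\<close> demands.\<close>
  define \<chi>' where "\<chi>' i j = (if i = j then Ide C (Z i) else \<chi> i j)" for i j
  have ZO: "\<And>i. i \<in> I \<Longrightarrow> Z i \<in> Obj C" using Hom_Obj[OF v(2)] by blast
  have \<chi>': "\<chi>' i j \<in> Hom C (Z i) (Z j)" "\<chi>' i j \<cdot> v i = v j" if "(i, j) \<in> r" for i j
    using \<chi>[OF that] Ide_Hom[OF ZO] Ide_Comp[OF v(2)] that r unfolding \<chi>'_def by auto
  have Z_sys: "directed_system C I r Z \<chi>'"
    unfolding directed_system_def
  proof (intro conjI allI impI)
    fix i j k assume ij: "(i, j) \<in> r" and jk: "(j, k) \<in> r"
    have ik: "(i, k) \<in> r" using trans ij jk by (rule transD)
    have i: "i \<in> I" using ij r by auto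
    have "(\<chi>' j k \<cdot> \<chi>' i j) \<cdot> v i = \<chi>' i k \<cdot> v i"
      using Comp_assoc[OF v(2)[OF i] \<chi>'(1)[OF ij] \<chi>'(1)[OF jk]] \<chi>'(2) ij jk ik by simp
    thus "\<chi>' j k \<cdot> \<chi>' i j = \<chi>' i k"
      using epiD[OF _ v(2)[OF i] Comp_Hom[OF \<chi>'(1)[OF ij] \<chi>'(1)[OF jk]] \<chi>'(1)[OF ik]] v'[OF i i i]
      by blast
  qed (use I_dir ZO \<chi>'(1) in \<open>auto simp: \<chi>'_def[of i i for i]\<close>)
  obtain O' where O': "is_zero_object C O'" using has_zero_object by blast
  hence OO: "O' \<in> Obj C" unfolding is_zero_object_def by simp
  \<comment> \<open>Composed with the epimorphisms \<open>v a\<close>, a cocone on the cokernels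
    gives the same morphism out of \<open>Q\<close> for every index, by directedness. It kills each
    \<open>m j\<close>, so \<open>union\<close> makes it zero.\<close>
  have Z_null: "c i = Null C (Z i) Y" if c: "is_cocone C I r Z \<chi>' Y c" and i: "i \<in> I" for Y c i
  proof -
    have YO: "Y \<in> Obj C" and cH: "\<And>a. a \<in> I \<Longrightarrow> c a \<in> Hom C (Z a) Y"
      and c\<chi>: "\<And>a b. (a, b) \<in> r \<Longrightarrow> c b \<cdot> \<chi>' a b = c a"
      using c unfolding is_cocone_def by auto
    have step: "c a \<cdot> v a = c b \<cdot> v b" if "(a, b) \<in> r" for a b
    proof -
      have a: "a \<in> I" and b: "b \<in> I" using that r by auto
      show ?thesis
        using Comp_assoc[OF v(2)[OF a] \<chi>'(1)[OF that] cH[OF b]] c\<chi>[OF that] \<chi>'(2)[OF that] by simp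
    qed
    have const: "c i \<cdot> v i = c j \<cdot> v j" if "j \<in> I" for j
      using dir[OF i that] step by metis
    have "(c i \<cdot> v i) \<cdot> m j = Null C (X j) Y" if j: "j \<in> I" for j
      using const[OF j] Comp_assoc[OF m(1)[OF j] v(2)[OF j] cH[OF j]] v'[OF j j j]
        Comp_Null[OF cH[OF j]] Hom_Obj[OF m(1)[OF j]] by simp
    hence "c i \<cdot> v i = Null C Q Y" using union Comp_Hom[OF v(2)[OF i] cH[OF i]] by blast
    thus ?thesis using epi_null[OF _ v(2)[OF i] cH[OF i]] v'[OF i i i] by blast
  qed
  have Z_lim: "is_direct_limit C I r Z \<chi>' O' (\<lambda>i. Null C (Z i) O')"
    unfolding is_direct_limit_def
  proof (intro conjI allI impI)
    show "is_cocone C I r Z \<chi>' O' (\<lambda>i. Null C (Z i) O')"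
      using OO ZO Null_Hom Null_Comp[OF \<chi>'(1) OO] unfolding is_cocone_def by auto
    fix Y c assume c: "is_cocone C I r Z \<chi>' Y c"
    hence YO: "Y \<in> Obj C" unfolding is_cocone_def by simp
    show "\<exists>!h. h \<in> Hom C O' Y \<and> (\<forall>i\<in>I. h \<cdot> Null C (Z i) O' = c i)"
    proof (rule ex1I[of _ "Null C O' Y"])
      show "Null C O' Y \<in> Hom C O' Y \<and> (\<forall>i\<in>I. Null C O' Y \<cdot> Null C (Z i) O' = c i)"
        using Null_Hom OO YO Z_null[OF c] Comp_Null ZO by simp
    qed (use zero_object_Hom[OF O'] in blast)
  qed (rule Z_sys)
  let ?\<psi> = "\<lambda>i j. Ide C Q"
  have Q_lim: "is_direct_limit C I r (\<lambda>_. Q) ?\<psi> Q (\<lambda>_. Ide C Q)"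
    unfolding is_direct_limit_def
  proof (intro conjI allI impI)
    show "directed_system C I r (\<lambda>_. Q) ?\<psi>"
      using I_dir QO Ide_Hom Comp_Ide unfolding directed_system_def by auto
    show "is_cocone C I r (\<lambda>_. Q) ?\<psi> Q (\<lambda>_. Ide C Q)"
      using QO Ide_Hom[OF QO] Comp_Ide[OF Ide_Hom[OF QO]] unfolding is_cocone_def by auto
    fix Y c assume c: "is_cocone C I r (\<lambda>_. Q) ?\<psi> Y c"
    hence cH: "\<And>i. i \<in> I \<Longrightarrow> c i \<in> Hom C Q Y" unfolding is_cocone_def by simp
    have "c i = c j" if "(i, j) \<in> r" for i j
      using c that r Comp_Ide[OF cH[of j]] unfolding is_cocone_def by force
    \<comment> \<open>Directedness connects \<open>i0\<close> with every \<open>i\<close> through a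
      common upper bound; this is why the constant system has limit \<open>Q\<close> and not a
      larger coproduct.\<close>
    hence const: "\<And>i. i \<in> I \<Longrightarrow> c i = c i0" using dir[OF i0] by metis
    show "\<exists>!h. h \<in> Hom C Q Y \<and> (\<forall>i\<in>I. h \<cdot> Ide C Q = c i)"
    proof (rule ex1I[of _ "c i0"])
      show "c i0 \<in> Hom C Q Y \<and> (\<forall>i\<in>I. c i0 \<cdot> Ide C Q = c i)"
        using cH[OF i0] const Comp_Ide by auto
    qed (use Comp_Ide i0 in auto)
  qed
  have "short_exact C f (Null C Q O')"
  proof (rule direct_limits_exact[OF I L Q_lim Z_lim])
    show "system_morphism C I r X \<phi> (\<lambda>_. Q) ?\<psi> m"
      using m(1) m\<phi> Ide_Comp[OF m(1)] r unfolding system_morphism_def by auto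
    show "system_morphism C I r (\<lambda>_. Q) ?\<psi> Z \<chi>' v"
      using v(2) \<chi>'(2) Comp_Ide[OF v(2)] r unfolding system_morphism_def by auto
    show "\<forall>i\<in>I. Null C Q O' \<cdot> Ide C Q = Null C (Z i) O' \<cdot> v i"
      using Comp_Ide[OF Null_Hom[OF QO OO]] Null_Comp[OF v(2) OO] by auto
  qed (use exact f Ide_Comp[OF m(1)] m(1) Null_Hom QO OO in auto)
  hence "is_kernel C f (Null C Q O')" unfolding short_exact_def by blast
  note F = is_kernel_iff[OF f(1) Null_Hom[OF QO OO], THEN iffD1, OF this]
  \<comment> \<open>Every morphism into \<open>Q\<close> composes to zero with the map into the zero
    object, so already the identity of \<open>Q\<close> factors through the kernel \<open>f\<close>.
    As \<open>f\<close> is mono, \<open>u\<close> is its two-sided inverse.\<close>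
  obtain u where u: "u \<in> Hom C Q L" "f \<cdot> u = Ide C Q"
    using F Ide_Hom[OF QO] Comp_Ide[OF Null_Hom[OF QO OO]] by blast
  have "f \<cdot> (u \<cdot> f) = f \<cdot> Ide C L"
    using Comp_assoc[OF f(1) u(1) f(1)] u Ide_Comp[OF f(1)] Comp_Ide[OF f(1)] by simp
  hence uf: "u \<cdot> f = Ide C L"
    using monoD[OF _ f(1) Comp_Hom[OF f(1) u(1)] Ide_Hom] F Hom_Obj[OF f(1)] by blast
  have um: "u \<cdot> m i = l i" if "i \<in> I" for i
    using f(2)[OF that] Comp_assoc[OF l[OF that] f(1) u(1)] uf Ide_Comp[OF l[OF that]] by simp
  have "\<exists>!h. h \<in> Hom C Q Y \<and> (\<forall>i\<in>I. h \<cdot> m i = c i)" if c: "is_cocone C I r X \<phi> Y c" for Y c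
  proof -
    obtain h where h: "h \<in> Hom C L Y" "\<forall>i\<in>I. h \<cdot> l i = c i"
      and h_uniq: "\<And>h'. h' \<in> Hom C L Y \<Longrightarrow> \<forall>i\<in>I. h' \<cdot> l i = c i \<Longrightarrow> h' = h"
      using univ[OF c] by metis
    show ?thesis
    proof (rule ex1I[of _ "h \<cdot> u"])
      show "h \<cdot> u \<in> Hom C Q Y \<and> (\<forall>i\<in>I. (h \<cdot> u) \<cdot> m i = c i)"
        using Comp_Hom[OF u(1) h(1)] Comp_assoc[OF m(1) u(1) h(1)] um h(2) by auto
      fix g assume g: "g \<in> Hom C Q Y \<and> (\<forall>i\<in>I. g \<cdot> m i = c i)"
      have "g \<cdot> f = h"
        using h_uniq[of "g \<cdot> f"] g Comp_Hom[OF f(1)] Comp_assoc[OF l f(1)] f(2) by auto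
      thus "g = h \<cdot> u" using g u Comp_assoc[OF u(1) f(1), of g Y] Comp_Ide[of g Q Y] by auto
    qed
  qed
  thus ?thesis using X m_cocone unfolding is_direct_limit_def by blast
qed

end

section \<open>Quotients of coproducts as directed unions\<close>

context grothendieck_category
begin

text \<open>Splitting off one summand yields a split short exact sequence
  \<open>M -> N -> X i\<close>, so zero objects and extensions suffice. Only these are assumed
  because the lemma serves to prove closure of a class under arbitrary coproducts.\<close>

lemma finite_coproduct_closed:
  fixes J :: "'u set"
  assumes zero: "\<And>Z. is_zero_object C Z \<Longrightarrow> Z \<in> L"
    and ext: "\<And>f g. \<lbrakk>short_exact C f g; Dom C f \<in> L; Cod C g \<in> L\<rbrakk> \<Longrightarrow> Cod C f \<in> L"
    and L: "L \<subseteq> Obj C"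
    and J: "finite J" "small U J" "\<forall>j\<in>J. X j \<in> L" and N: "is_coproduct C J X N \<kappa>"
  shows "N \<in> L"
  using J N
proof (induction J arbitrary: N \<kappa> rule: finite_induct)
  case empty
  thus ?case using zero empty_coproduct_iff by blast
next
  case (insert i J)
  have N: "is_coproduct C (insert i J) X N \<kappa>" by fact
  have J: "small U J" using insert.prems(1) small_mono by blast
  have XL: "X i \<in> L" "\<forall>j\<in>J. X j \<in> L" using insert.prems(2) by auto
  have XO: "X i \<in> Obj C" "\<forall>j\<in>J. X j \<in> Obj C" using XL L by auto
  obtain M \<mu> where M: "is_coproduct C J X M \<mu>" using has_coproducts[OF J XO(2)] by blast
  note NO = coproduct_Obj[OF N] and MO = coproduct_Obj[OF M]
  have \<kappa>: "\<kappa> i \<in> Hom C (X i) N" "\<And>j. j \<in> J \<Longrightarrow> \<kappa> j \<in> Hom C (X j) N"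
    using coproduct_inj[OF N] by auto
  note \<mu> = coproduct_inj[OF M]
  obtain t where t: "t \<in> Hom C M N" "\<forall>j\<in>J. t \<cdot> \<mu> j = \<kappa> j"
    using coproduct_desc[OF M NO, of \<kappa>] \<kappa>(2) by blast
  have "\<forall>j\<in>insert i J. (if j = i then Ide C (X i) else Null C (X j) (X i)) \<in> Hom C (X j) (X i)"
    using XO Ide_Hom Null_Hom by simp
  then obtain p where "p \<in> Hom C N (X i)"
      "\<forall>j\<in>insert i J. p \<cdot> \<kappa> j = (if j = i then Ide C (X i) else Null C (X j) (X i))"
    by (rule coproduct_desc[OF N XO(1)])
  hence p: "p \<in> Hom C N (X i)" "p \<cdot> \<kappa> i = Ide C (X i)" "\<And>j. j \<in> J \<Longrightarrow> p \<cdot> \<kappa> j = Null C (X j) (X i)"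
    using insert.hyps(2) by auto
  have "\<forall>j\<in>insert i J. (if j = i then Null C (X i) M else \<mu> j) \<in> Hom C (X j) M"
    using XO MO Null_Hom \<mu> by simp
  then obtain s where "s \<in> Hom C N M"
      "\<forall>j\<in>insert i J. s \<cdot> \<kappa> j = (if j = i then Null C (X i) M else \<mu> j)"
    by (rule coproduct_desc[OF N MO])
  hence s: "s \<in> Hom C N M" "s \<cdot> \<kappa> i = Null C (X i) M" "\<And>j. j \<in> J \<Longrightarrow> s \<cdot> \<kappa> j = \<mu> j"
    using insert.hyps(2) by auto
  have st: "s \<cdot> t = Ide C M"
    by (rule coproduct_eqI[OF M Comp_Hom[OF t(1) s(1)] Ide_Hom[OF MO]])
      (use Comp_assoc[OF \<mu> t(1) s(1)] s(3) t(2) Ide_Comp[OF \<mu>] in simp)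
  have pt: "p \<cdot> t = Null C M (X i)"
    by (rule coproduct_eqI[OF M Comp_Hom[OF t(1) p(1)] Null_Hom[OF MO XO(1)]])
      (use Comp_assoc[OF \<mu> t(1) p(1)] p(3) t(2) Null_Comp[OF \<mu> XO(1)] in simp)
  have kp: "\<kappa> i \<cdot> p \<in> Hom C N N" and ts: "t \<cdot> s \<in> Hom C N N"
    using Comp_Hom \<kappa> p t s by blast+
  \<comment> \<open>Checked on the injections of \<open>N\<close>: on \<open>\<kappa> i\<close> only
    the first summand survives, on \<open>\<kappa> j\<close> with \<open>j \<in> J\<close> only the
    second. Both universal properties of the sequence are read off from this decomposition of the
    identity.\<close>
  have decomp: "\<kappa> i \<cdot> p \<oplus> t \<cdot> s = Ide C N"
  proof (rule coproduct_eqI[OF N Add_Hom[OF kp ts] Ide_Hom[OF NO]])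
    fix j assume "j \<in> insert i J"
    moreover have "(\<kappa> i \<cdot> p \<oplus> t \<cdot> s) \<cdot> \<kappa> i = Ide C N \<cdot> \<kappa> i"
      using Add_Comp[OF \<kappa>(1) kp ts] Comp_assoc[OF \<kappa>(1) p(1) \<kappa>(1)] Comp_assoc[OF \<kappa>(1) s(1) t(1)]
        p(2) s(2) Comp_Ide[OF \<kappa>(1)] Comp_Null[OF t(1) XO(1)] Add_Null[OF \<kappa>(1)] Ide_Comp[OF \<kappa>(1)]
      by simp
    moreover have "(\<kappa> i \<cdot> p \<oplus> t \<cdot> s) \<cdot> \<kappa> j = Ide C N \<cdot> \<kappa> j" if j: "j \<in> J"
      using Add_Comp[OF \<kappa>(2)[OF j] kp ts] Comp_assoc[OF \<kappa>(2)[OF j] p(1) \<kappa>(1)]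
        Comp_assoc[OF \<kappa>(2)[OF j] s(1) t(1)] p(3)[OF j] s(3)[OF j] t(2) j
        Comp_Null[OF \<kappa>(1)] XO(2) Null_Add[OF \<kappa>(2)[OF j]] Ide_Comp[OF \<kappa>(2)[OF j]]
      by simp
    ultimately show "(\<kappa> i \<cdot> p \<oplus> t \<cdot> s) \<cdot> \<kappa> j = Ide C N \<cdot> \<kappa> j" by blast
  qed
  have "\<exists>u \<in> Hom C W M. t \<cdot> u = h" if h: "h \<in> Hom C W N" "p \<cdot> h = Null C W (X i)" for W h
  proof -
    have sh: "s \<cdot> h \<in> Hom C W M" using Comp_Hom h s by blast
    have "h = (\<kappa> i \<cdot> p \<oplus> t \<cdot> s) \<cdot> h" using decomp Ide_Comp[OF h(1)] by simp
    also have "\<dots> = t \<cdot> (s \<cdot> h)"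
      using Add_Comp[OF h(1) kp ts] Comp_assoc[OF h(1) p(1) \<kappa>(1)] Comp_assoc[OF h(1) s(1) t(1)] h(2)
        Comp_Null[OF \<kappa>(1)] Hom_Obj[OF h(1)] Null_Add[OF Comp_Hom[OF sh t(1)]] by simp
    finally show ?thesis using sh by metis
  qed
  hence "is_kernel C t p"
    using is_kernel_iff[OF t(1) p(1)] split_mono[OF t(1) s(1) st] pt by blast
  moreover have "\<exists>u \<in> Hom C (X i) W. u \<cdot> p = h" if h: "h \<in> Hom C N W" "h \<cdot> t = Null C M W" for W h
  proof -
    have hk: "h \<cdot> \<kappa> i \<in> Hom C (X i) W" using Comp_Hom h \<kappa> by blast
    have "h = h \<cdot> (\<kappa> i \<cdot> p \<oplus> t \<cdot> s)" using decomp Comp_Ide[OF h(1)] by simp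
    also have "\<dots> = (h \<cdot> \<kappa> i) \<cdot> p"
      using Comp_Add[OF kp ts h(1)] Comp_assoc[OF p(1) \<kappa>(1) h(1)] Comp_assoc[OF s(1) t(1) h(1)] h(2)
        Null_Comp[OF s(1)] Hom_Obj[OF h(1)] Add_Null[OF Comp_Hom[OF p(1) hk]] by simp
    finally show ?thesis using hk by metis
  qed
  hence "is_cokernel C p t"
    using is_cokernel_iff[OF p(1) t(1)] split_epi[OF p(1) \<kappa>(1) p(2)] pt by blast
  ultimately have "short_exact C t p" unfolding short_exact_def by blast
  moreover have "M \<in> L" using insert.IH[OF J XL(2) M] .
  ultimately show ?case using ext[of t p] HomD[OF t(1)] HomD[OF p(1)] XL(1) by simp
qed

text \<open>The index relation is inclusion of subobjects of \<open>Q\<close>. Since the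
  \<open>m k\<close> are monos, the transition morphisms are unique, and the identity and
  composition laws of a directed system follow by cancelling \<open>m k\<close>.\<close>

lemma filtered_union:
  fixes K :: "'u set"
  assumes K: "small U K" "K \<noteq> {}" and QO: "Q \<in> Obj C"
    and m: "\<And>k. k \<in> K \<Longrightarrow> m k \<in> Hom C (Y k) Q" "\<And>k. k \<in> K \<Longrightarrow> is_mono C (m k)"
    and dir: "\<And>i j. \<lbrakk>i \<in> K; j \<in> K\<rbrakk> \<Longrightarrow> \<exists>k\<in>K. (\<exists>u \<in> Hom C (Y i) (Y k). m k \<cdot> u = m i) \<and>
      (\<exists>v \<in> Hom C (Y j) (Y k). m k \<cdot> v = m j)"
    and union: "\<And>Z h. \<lbrakk>h \<in> Hom C Q Z; \<forall>k\<in>K. h \<cdot> m k = Null C (Y k) Z\<rbrakk> \<Longrightarrow> h = Null C Q Z"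
  obtains r \<phi> where "is_direct_limit C K r Y \<phi> Q m"
proof -
  define r where "r = {(i, j). i \<in> K \<and> j \<in> K \<and> (\<exists>u \<in> Hom C (Y i) (Y j). m j \<cdot> u = m i)}"
  have rK: "i \<in> K" "j \<in> K" if "(i, j) \<in> r" for i j using that unfolding r_def by auto
  have "\<exists>u. u \<in> Hom C (Y i) (Y j) \<and> m j \<cdot> u = m i" if "(i, j) \<in> r" for i j
    using that unfolding r_def by blast
  then obtain \<phi> where \<phi>: "\<And>i j. (i, j) \<in> r \<Longrightarrow> \<phi> i j \<in> Hom C (Y i) (Y j)"
    "\<And>i j. (i, j) \<in> r \<Longrightarrow> m j \<cdot> \<phi> i j = m i"
    by metis
  have uniq: "u = v" if "j \<in> K" "u \<in> Hom C W (Y j)" "v \<in> Hom C W (Y j)" "m j \<cdot> u = m j \<cdot> v" for u v W j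
    using monoD[OF m(2,1)] that by blast
  have YO: "\<And>k. k \<in> K \<Longrightarrow> Y k \<in> Obj C" using Hom_Obj[OF m(1)] by blast
  have refl: "(k, k) \<in> r" if "k \<in> K" for k
    using that Ide_Hom[OF YO[OF that]] Comp_Ide[OF m(1)[OF that]] unfolding r_def by auto
  have comp: "\<phi> j k \<cdot> \<phi> i j \<in> Hom C (Y i) (Y k)" "m k \<cdot> (\<phi> j k \<cdot> \<phi> i j) = m i"
    if ij: "(i, j) \<in> r" and jk: "(j, k) \<in> r" for i j k
    using Comp_Hom[OF \<phi>(1)[OF ij] \<phi>(1)[OF jk]] \<phi>(2)[OF ij] \<phi>(2)[OF jk]
      Comp_assoc[OF \<phi>(1)[OF ij] \<phi>(1)[OF jk] m(1)[OF rK(2)[OF jk]]] by auto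
  have tr: "(i, k) \<in> r" if ij: "(i, j) \<in> r" and jk: "(j, k) \<in> r" for i j k
    using comp[OF ij jk] rK(1)[OF ij] rK(2)[OF jk] unfolding r_def by blast
  have "directed_system C K r Y \<phi>"
    unfolding directed_system_def directed_set_def preorder_on_def
  proof (intro conjI)
    show "r \<subseteq> K \<times> K" using rK by auto
    show "refl_on K r" using refl unfolding refl_on_def by blast
    show "trans r" using tr unfolding trans_def by blast
    show "\<forall>i\<in>K. \<forall>j\<in>K. \<exists>k\<in>K. (i, k) \<in> r \<and> (j, k) \<in> r"
      using dir unfolding r_def by blast
    show "\<forall>i\<in>K. \<phi> i i = Ide C (Y i)"
      using uniq \<phi>[OF refl] Ide_Hom[OF YO] Comp_Ide[OF m(1)] by metis
    show "\<forall>i j k. (i, j) \<in> r \<longrightarrow> (j, k) \<in> r \<longrightarrow> \<phi> j k \<cdot> \<phi> i j = \<phi> i k"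
      using uniq[OF rK(2) comp(1) \<phi>(1)] comp(2) \<phi>(2) tr by metis
  qed (use K(2) YO \<phi>(1) in auto)
  hence "is_direct_limit C K r Y \<phi> Q m" by (rule directed_union[OF K(1) _ QO m \<phi>(2) union])
  thus thesis by (rule that)
qed

text \<open>Each finite subset of \<open>I\<close> contributes the image in \<open>Q\<close> of its
  partial coproduct. These images are directed because unions of two finite sets are finite, and
  they exhaust \<open>Q\<close> because the singletons reach every \<open>\<iota> i\<close> and
  \<open>e\<close> is epi.\<close>

lemma coproduct_quotient_direct_limit:
  fixes I :: "'u set"
  assumes univ: "universe U" and I: "small U I" and X: "\<forall>i\<in>I. X i \<in> Obj C"
    and S: "is_coproduct C I X S \<iota>" and e: "e \<in> Hom C S Q" "is_epi C e"
  obtains K :: "'u set" and r Y \<phi> m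
  where "small U K" "is_direct_limit C K r Y \<phi> Q m"
    "\<And>k. k \<in> K \<Longrightarrow> \<exists>J N \<kappa> d. J \<subseteq> I \<and> finite J \<and> is_coproduct C J X N \<kappa> \<and>
       d \<in> Hom C N (Y k) \<and> is_epi C d"
proof -
  \<comment> \<open>\<open>P J Y m\<close> makes the subobject \<open>m\<close> an image of the
    partial coproduct over \<open>J\<close>. Coproduct and factorization stay existential, as
    \<open>mono\<close> compares any two such images whatever choices were made.\<close>
  define P where "P J Y m \<longleftrightarrow> m \<in> Hom C Y Q \<and> is_mono C m \<and>
    (\<exists>N \<kappa> t d. is_coproduct C J X N \<kappa> \<and> t \<in> Hom C N S \<and> (\<forall>j\<in>J. t \<cdot> \<kappa> j = \<iota> j) \<and>
       d \<in> Hom C N Y \<and> is_epi C d \<and> m \<cdot> d = e \<cdot> t)" for J Y m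
  note SO = coproduct_Obj[OF S] and \<iota> = coproduct_inj[OF S]
  have ex: "\<exists>Y m. P J Y m" if J: "J \<subseteq> I" for J
  proof -
    have "\<forall>j\<in>J. X j \<in> Obj C" using X J by auto
    then obtain N \<kappa> where N: "is_coproduct C J X N \<kappa>" using has_coproducts small_mono[OF I J] by metis
    obtain t where t: "t \<in> Hom C N S" "\<forall>j\<in>J. t \<cdot> \<kappa> j = \<iota> j"
      using coproduct_desc[OF N SO, of \<iota>] \<iota> J by blast
    obtain Y d m where "d \<in> Hom C N Y" "m \<in> Hom C Y Q" "is_epi C d" "is_mono C m" "m \<cdot> d = e \<cdot> t"
      using image[OF Comp_Hom[OF t(1) e(1)]] .
    thus ?thesis using N t unfolding P_def by blast
  qed
  have mono: "\<exists>u \<in> Hom C Y Y'. m' \<cdot> u = m"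
    if JJ': "J \<subseteq> J'" "J' \<subseteq> I" and P: "P J Y m" "P J' Y' m'" for J J' Y Y' m m'
  proof -
    obtain N \<kappa> t d where N: "is_coproduct C J X N \<kappa>" and t: "t \<in> Hom C N S" "\<forall>j\<in>J. t \<cdot> \<kappa> j = \<iota> j"
      and d: "d \<in> Hom C N Y" "is_epi C d" "m \<cdot> d = e \<cdot> t"
      using P(1) unfolding P_def by blast
    obtain N' \<kappa>' t' d' where N': "is_coproduct C J' X N' \<kappa>'"
      and t': "t' \<in> Hom C N' S" "\<forall>j\<in>J'. t' \<cdot> \<kappa>' j = \<iota> j"
      and d': "d' \<in> Hom C N' Y'" "m' \<cdot> d' = e \<cdot> t'"
      using P(2) unfolding P_def by blast
    have m: "m \<in> Hom C Y Q" and m': "m' \<in> Hom C Y' Q" "is_mono C m'" using P unfolding P_def by auto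
    note \<kappa> = coproduct_inj[OF N] and \<kappa>' = coproduct_inj[OF N']
    obtain x where x: "x \<in> Hom C N N'" "\<forall>j\<in>J. x \<cdot> \<kappa> j = \<kappa>' j"
      using coproduct_desc[OF N coproduct_Obj[OF N'], of \<kappa>'] \<kappa>' JJ'(1) by blast
    have "t' \<cdot> x = t"
      by (rule coproduct_eqI[OF N Comp_Hom[OF x(1) t'(1)] t(1)])
        (use Comp_assoc[OF \<kappa> x(1) t'(1)] x(2) t(2) t'(2) JJ'(1) in auto)
    hence "m \<cdot> d = (m' \<cdot> d') \<cdot> x" using d(3) d'(2) Comp_assoc[OF x(1) t'(1) e(1)] by simp
    thus ?thesis using image_mono[OF d(2,1) m d'(1) m'(2,1) x(1)] by metis
  qed
  \<comment> \<open>Direct limits are indexed by sets of type \<open>'u set\<close>, so finite subsets of \<open>I\<close> are coded by elements of \<open>'u\<close>.\<close>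
  define Fin where "Fin = {J. J \<subseteq> I \<and> finite J}"
  have PowI: "small U (Pow I)" using univ I unfolding universe_def by blast
  then obtain c :: "'u set \<Rightarrow> 'u" where c: "inj_on c (Pow I)"
    unfolding small_def using card_of_ordLeq[of "Pow I" "UNIV :: 'u set"] ordLess_imp_ordLeq by blast
  define K where "K = c ` Fin"
  have "small U (c ` Pow I)"
    using PowI card_of_image[of c "Pow I"] ordLeq_ordLess_trans unfolding small_def by blast
  hence K: "small U K" by (rule small_mono) (auto simp: K_def Fin_def)
  have "\<forall>k\<in>K. \<exists>J Y m. J \<in> Fin \<and> c J = k \<and> P J Y m"
    using ex unfolding K_def Fin_def by blast
  then obtain J Y m where "\<forall>k\<in>K. J k \<in> Fin \<and> c (J k) = k \<and> P (J k) (Y k) (m k)"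
    by metis
  hence J: "\<And>k. k \<in> K \<Longrightarrow> J k \<subseteq> I" "\<And>k. k \<in> K \<Longrightarrow> finite (J k)" "\<And>k. k \<in> K \<Longrightarrow> c (J k) = k"
    and P: "\<And>k. k \<in> K \<Longrightarrow> P (J k) (Y k) (m k)"
    unfolding Fin_def by auto
  \<comment> \<open>Injectivity of \<open>c\<close> on \<open>Pow I\<close> lets \<open>J\<close>
    decode the index, so every finite subset of \<open>I\<close> occurs as some \<open>J k\<close>;
    unions, singletons and the empty set are obtained from here.\<close>
  have Jc: "c J' \<in> K \<and> J (c J') = J'" if "J' \<subseteq> I" "finite J'" for J'
  proof -
    have "c J' \<in> K" using that unfolding K_def Fin_def by blast
    thus ?thesis using J(1,3) c that(1) unfolding inj_on_def by auto
  qed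
  have m: "\<And>k. k \<in> K \<Longrightarrow> m k \<in> Hom C (Y k) Q" "\<And>k. k \<in> K \<Longrightarrow> is_mono C (m k)"
    using P unfolding P_def by auto
  have dir: "\<exists>k\<in>K. (\<exists>u \<in> Hom C (Y i) (Y k). m k \<cdot> u = m i) \<and> (\<exists>v \<in> Hom C (Y j) (Y k). m k \<cdot> v = m j)"
    if i: "i \<in> K" and j: "j \<in> K" for i j
  proof -
    have "J i \<union> J j \<subseteq> I" "finite (J i \<union> J j)" using J i j by auto
    then obtain k where k: "k \<in> K" "J k = J i \<union> J j" using Jc by blast
    show ?thesis
      using mono[OF _ J(1)[OF k(1)] P[OF i] P[OF k(1)]] mono[OF _ J(1)[OF k(1)] P[OF j] P[OF k(1)]] k
      by auto
  qed
  have union: "h = Null C Q Z" if h: "h \<in> Hom C Q Z" "\<forall>k\<in>K. h \<cdot> m k = Null C (Y k) Z" for Z h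
  proof -
    have ZO: "Z \<in> Obj C" using Hom_Obj[OF h(1)] by simp
    have "h \<cdot> e = Null C S Z"
    proof (rule coproduct_eqI[OF S Comp_Hom[OF e(1) h(1)] Null_Hom[OF SO ZO]])
      fix i assume i: "i \<in> I"
      then obtain k where k: "k \<in> K" "J k = {i}" using Jc[of "{i}"] by auto
      then obtain N \<kappa> t d where N: "is_coproduct C {i} X N \<kappa>" and t: "t \<in> Hom C N S" "t \<cdot> \<kappa> i = \<iota> i"
        and d: "d \<in> Hom C N (Y k)" "m k \<cdot> d = e \<cdot> t"
        using P[OF k(1)] unfolding P_def by auto
      have \<kappa>: "\<kappa> i \<in> Hom C (X i) N" using coproduct_inj[OF N] by simp
      have "(h \<cdot> e) \<cdot> t = (h \<cdot> m k) \<cdot> d"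
        using Comp_assoc[OF t(1) e(1) h(1)] Comp_assoc[OF d(1) m(1)[OF k(1)] h(1)] d(2) by simp
      also have "\<dots> = Null C N Z" using h(2) k(1) Null_Comp[OF d(1) ZO] by simp
      finally have "(h \<cdot> e) \<cdot> (t \<cdot> \<kappa> i) = Null C (X i) Z"
        using Comp_assoc[OF \<kappa> t(1) Comp_Hom[OF e(1) h(1)]] Null_Comp[OF \<kappa> ZO] by simp
      thus "(h \<cdot> e) \<cdot> \<iota> i = Null C S Z \<cdot> \<iota> i" using t(2) Null_Comp[OF \<iota>[OF i] ZO] by simp
    qed
    thus ?thesis using epi_null[OF e(2,1) h(1)] by blast
  qed
  have "K \<noteq> {}" using Jc[of "{}"] by blast
  from filtered_union[of K Q m Y, OF K this Hom_Obj(2)[OF e(1)] m dir union]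
  obtain r \<phi> where "is_direct_limit C K r Y \<phi> Q m" by blast
  moreover have "\<exists>J N \<kappa> d. J \<subseteq> I \<and> finite J \<and> is_coproduct C J X N \<kappa> \<and> d \<in> Hom C N (Y k) \<and> is_epi C d"
    if "k \<in> K" for k
    using J(1,2)[OF that] P[OF that] unfolding P_def by blast
  ultimately show thesis using that K by blast
qed

end

section \<open>Left exact functors and wide Morita contexts\<close>

locale left_exact_functor =
  C: abelian_category C + D: abelian_category D
  for C :: "('o1, 'm1) addcat" and D :: "('o2, 'm2) addcat" +
  fixes F :: "('o1, 'm1, 'o2, 'm2) funct"
  assumes left_exact: "left_exact C D F"
begin

lemma additive: "additive_functor C D F"
  using left_exact unfolding left_exact_def by blast

lemma F_Obj: "X \<in> Obj C \<Longrightarrow> omap F X \<in> Obj D"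
  and F_Hom: "f \<in> Hom C X Y \<Longrightarrow> amap F f \<in> Hom D (omap F X) (omap F Y)"
  and F_Ide: "X \<in> Obj C \<Longrightarrow> amap F (Ide C X) = Ide D (omap F X)"
  and F_Comp: "\<lbrakk>f \<in> Hom C X Y; g \<in> Hom C Y Z\<rbrakk>
    \<Longrightarrow> amap F (g \<cdot>\<^bsub>C\<^esub> f) = amap F g \<cdot>\<^bsub>D\<^esub> amap F f"
  and F_Add: "\<lbrakk>f \<in> Hom C X Y; g \<in> Hom C X Y\<rbrakk>
    \<Longrightarrow> amap F (f \<oplus>\<^bsub>C\<^esub> g) = amap F f \<oplus>\<^bsub>D\<^esub> amap F g"
  using additive unfolding additive_functor_def by blast+

lemma F_Null:
  assumes X: "X \<in> Obj C" and Y: "Y \<in> Obj C"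
  shows "amap F (Null C X Y) = Null D (omap F X) (omap F Y)"
proof -
  have N: "Null C X Y \<in> Hom C X Y" using C.Null_Hom X Y .
  show ?thesis
    using D.Add_cancel[OF F_Hom[OF N] F_Hom[OF N]] F_Add[OF N N] C.Null_Add[OF N] by simp
qed

lemma F_kernel: "is_kernel C k f \<Longrightarrow> is_kernel D (amap F k) (amap F f)"
  using left_exact unfolding left_exact_def by blast

text \<open>A monomorphism is a kernel of its cokernel, and kernels are preserved.\<close>

lemma F_mono:
  assumes m: "is_mono C m" "m \<in> Hom C X Y"
  shows "is_mono D (amap F m)"
proof -
  obtain Q q where q: "is_cokernel C q m" "q \<in> Hom C Y Q" using C.cokernel[OF m(2)] .
  have "is_kernel D (amap F m) (amap F q)"
    using F_kernel C.mono_kernel_of_cokernel[OF m q(1)] by blast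
  thus ?thesis using D.is_kernel_iff[OF F_Hom[OF m(2)] F_Hom[OF q(2)]] by blast
qed

lemma F_zero_object:
  assumes Z: "is_zero_object C Z"
  shows "is_zero_object D (omap F Z)"
proof -
  have ZO: "Z \<in> Obj C" using Z unfolding is_zero_object_def by blast
  show ?thesis
    using D.zero_object_iff[OF F_Obj[OF ZO]] F_Null[OF ZO ZO] F_Ide[OF ZO] C.zero_object_iff[OF ZO] Z
    by simp
qed

text \<open>\<open>F\<close> is not right exact, so the objects that \<open>F\<close> sends into \<open>T\<close> need not be closed under
  quotients.\<close>

lemma localizing_quotient_preimage:
  fixes U :: "'u itself"
  assumes univ: "universe U" and CU: "grothendieck_category U C" and DU: "grothendieck_category U D"
    and lim: "preserves_direct_limits U C D F" and T: "localizing_subcategory U D T"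
  shows "localizing_subcategory U C
    {N \<in> Obj C. \<forall>Q e. e \<in> Hom C N Q \<longrightarrow> is_epi C e \<longrightarrow> omap F Q \<in> T}"
    (is "localizing_subcategory U C ?L")
proof -
  interpret CU: grothendieck_category U C by (rule CU)
  interpret DU: grothendieck_category U D by (rule DU)
  have LI: "N \<in> ?L" if "N \<in> Obj C" "\<And>Q e. \<lbrakk>e \<in> Hom C N Q; is_epi C e\<rbrakk> \<Longrightarrow> omap F Q \<in> T" for N
    using that by blast
  have LD: "omap F Q \<in> T" if "N \<in> ?L" "e \<in> Hom C N Q" "is_epi C e" for N e Q
    using that by blast
  have quot: "N' \<in> ?L" if "N \<in> ?L" "is_epi C e" "e \<in> Hom C N N'" for N N' e
  proof (rule LI)
    show "N' \<in> Obj C" using C.Hom_Obj[OF that(3)] by simp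
    fix Q d assume d: "d \<in> Hom C N' Q" "is_epi C d"
    show "omap F Q \<in> T"
      using LD[OF that(1) C.Comp_Hom[OF that(3) d(1)] C.epi_comp[OF that(2,3) d(2,1)]] .
  qed
  have sub: "X \<in> ?L" if N: "N \<in> ?L" and m: "is_mono C m" "m \<in> Hom C X N" for N X m
  proof (rule LI)
    show "X \<in> Obj C" using C.Hom_Obj[OF m(2)] by simp
    fix Q e assume e: "e \<in> Hom C X Q" "is_epi C e"
    obtain K k where k: "is_kernel C k e" "k \<in> Hom C K X" using C.kernel[OF e(1)] .
    note k' = C.is_kernel_iff[OF k(2) e(1), THEN iffD1, OF k(1)]
    have ek: "is_cokernel C e k" using C.epi_cokernel_of_kernel[OF e(2,1) k(1)] .
    have mk: "m \<cdot>\<^bsub>C\<^esub> k \<in> Hom C K N" using C.Comp_Hom[OF k(2) m(2)] .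
    \<comment> \<open>\<open>Q\<close> is \<open>X\<close> modulo \<open>K\<close>; it embeds in
      \<open>R\<close>, which is \<open>N\<close> modulo \<open>K\<close>. As a quotient of
      \<open>N\<close>, \<open>R\<close> is sent into \<open>T\<close>, and \<open>F\<close>
      preserves the embedding.\<close>
    obtain R n where n: "is_cokernel C n (m \<cdot>\<^bsub>C\<^esub> k)" "n \<in> Hom C N R" using C.cokernel[OF mk] .
    note n' = C.is_cokernel_iff[OF n(2) mk, THEN iffD1, OF n(1)]
    have mono_mk: "is_mono C (m \<cdot>\<^bsub>C\<^esub> k)"
    proof (rule C.monoI[OF mk])
      fix W d assume d: "d \<in> Hom C W K" "m \<cdot>\<^bsub>C\<^esub> k \<cdot>\<^bsub>C\<^esub> d = Null C W N"
      have "k \<cdot>\<^bsub>C\<^esub> d = Null C W X"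
        using C.mono_null[OF m C.Comp_Hom[OF d(1) k(2)]] d(2) C.Comp_assoc[OF d(1) k(2) m(2)] by simp
      thus "d = Null C W K" using C.mono_null[OF _ k(2) d(1)] k' by blast
    qed
    have ker_n: "is_kernel C (m \<cdot>\<^bsub>C\<^esub> k) n" using C.mono_kernel_of_cokernel[OF mono_mk mk n(1)] .
    note ker_n' = C.is_kernel_iff[OF mk n(2), THEN iffD1, OF ker_n]
    have nm: "n \<cdot>\<^bsub>C\<^esub> m \<in> Hom C X R" using C.Comp_Hom[OF m(2) n(2)] .
    have nmk: "n \<cdot>\<^bsub>C\<^esub> m \<cdot>\<^bsub>C\<^esub> k = Null C K R" using C.Comp_assoc[OF k(2) m(2) n(2)] n' by simp
    \<comment> \<open>The kernel of the composite from \<open>X\<close> to \<open>R\<close> is again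
      \<open>K\<close>; this is what \<open>coimage_mono\<close> needs to make the comparison from
      \<open>Q\<close> to \<open>R\<close> mono.\<close>
    have "\<exists>u \<in> Hom C W K. k \<cdot>\<^bsub>C\<^esub> u = h"
      if h: "h \<in> Hom C W X" "n \<cdot>\<^bsub>C\<^esub> m \<cdot>\<^bsub>C\<^esub> h = Null C W R" for W h
    proof -
      have mh: "m \<cdot>\<^bsub>C\<^esub> h \<in> Hom C W N" using C.Comp_Hom[OF h(1) m(2)] .
      obtain u where u: "u \<in> Hom C W K" "m \<cdot>\<^bsub>C\<^esub> k \<cdot>\<^bsub>C\<^esub> u = m \<cdot>\<^bsub>C\<^esub> h"
        using ker_n' mh h(2) C.Comp_assoc[OF h(1) m(2) n(2)] by auto
      have "k \<cdot>\<^bsub>C\<^esub> u = h"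
        using C.monoD[OF m C.Comp_Hom[OF u(1) k(2)] h(1)] u(2) C.Comp_assoc[OF u(1) k(2) m(2)] by simp
      thus ?thesis using u(1) by blast
    qed
    hence ker_nm: "is_kernel C k (n \<cdot>\<^bsub>C\<^esub> m)" using C.is_kernel_iff[OF k(2) nm] k' nmk by blast
    obtain u where u: "u \<in> Hom C Q R" "u \<cdot>\<^bsub>C\<^esub> e = n \<cdot>\<^bsub>C\<^esub> m"
      using C.is_cokernel_iff[OF e(1) k(2), THEN iffD1, OF ek] nm nmk by blast
    have "is_mono C u" using C.coimage_mono[OF nm ker_nm ek e(1) u] .
    hence "is_mono D (amap F u)" using F_mono u(1) by blast
    moreover have "omap F R \<in> T" using LD[OF N n(2)] n' by blast
    ultimately show "omap F Q \<in> T" using D.localizing_subobject[OF T _ F_Hom[OF u(1)]] by blast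
  qed
  have ext: "Cod C f \<in> ?L" if fg: "short_exact C f g" and L: "Dom C f \<in> ?L" "Cod C g \<in> ?L" for f g
  proof (rule LI)
    define X Y Z where "X = Dom C f" "Y = Cod C f" "Z = Cod C g"
    have f: "f \<in> Hom C X Y" and g: "g \<in> Hom C Y Z"
      using fg unfolding short_exact_def is_kernel_def X_Y_Z_def Hom_def by auto
    show "Cod C f \<in> Obj C" using C.Hom_Obj[OF f] X_Y_Z_def by simp
    fix Q e assume "e \<in> Hom C (Cod C f) Q" and epi_e: "is_epi C e"
    hence e: "e \<in> Hom C Y Q" using X_Y_Z_def by simp
    \<comment> \<open>A quotient \<open>Q\<close> of the extension is itself an extension: of
      \<open>R\<close>, a quotient of \<open>Z\<close>, by the image \<open>I\<close> of
      \<open>X\<close> in \<open>Q\<close>, a quotient of \<open>X\<close>.\<close>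
    obtain I d m where d: "d \<in> Hom C X I" "is_epi C d" and m: "m \<in> Hom C I Q" "is_mono C m"
      and md: "m \<cdot>\<^bsub>C\<^esub> d = e \<cdot>\<^bsub>C\<^esub> f"
      using C.image[OF C.Comp_Hom[OF f e]] by metis
    obtain R c where c: "is_cokernel C c m" "c \<in> Hom C Q R" using C.cokernel[OF m(1)] .
    note c' = C.is_cokernel_iff[OF c(2) m(1), THEN iffD1, OF c(1)]
    have ce: "c \<cdot>\<^bsub>C\<^esub> e \<in> Hom C Y R" using C.Comp_Hom[OF e c(2)] .
    have "(c \<cdot>\<^bsub>C\<^esub> e) \<cdot>\<^bsub>C\<^esub> f = (c \<cdot>\<^bsub>C\<^esub> m) \<cdot>\<^bsub>C\<^esub> d"
      using md C.Comp_assoc[OF f e c(2)] C.Comp_assoc[OF d(1) m(1) c(2)] by simp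
    also have "\<dots> = Null C X R" using c' C.Null_Comp[OF d(1)] C.Hom_Obj[OF c(2)] by simp
    finally have "(c \<cdot>\<^bsub>C\<^esub> e) \<cdot>\<^bsub>C\<^esub> f = Null C X R" .
    moreover have "is_cokernel C g f" using fg unfolding short_exact_def by blast
    ultimately obtain u where u: "u \<in> Hom C Z R" "u \<cdot>\<^bsub>C\<^esub> g = c \<cdot>\<^bsub>C\<^esub> e"
      using C.is_cokernel_iff[OF g f] ce by blast
    have "is_epi C u" using C.epi_of_comp[OF g u(1)] u(2) C.epi_comp[OF epi_e e _ c(2)] c' by metis
    hence "omap F R \<in> T" using LD[OF _ u(1)] L(2) X_Y_Z_def by blast
    moreover have "omap F I \<in> T" using LD[OF _ d] L(1) X_Y_Z_def by blast
    \<comment> \<open>\<open>F\<close> keeps only left exactness of \<open>I -> Q -> R\<close>,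
      which is all that \<open>localizing_left_exact\<close> asks for.\<close>
    moreover have "is_kernel D (amap F m) (amap F c)"
      using F_kernel C.mono_kernel_of_cokernel[OF m(2,1) c(1)] by blast
    ultimately show "omap F Q \<in> T"
      using D.localizing_left_exact[OF T _ F_Hom[OF m(1)] F_Hom[OF c(2)]] by blast
  qed
  have zero: "Z \<in> ?L" if Z: "is_zero_object C Z" for Z
  proof (rule LI)
    show ZO: "Z \<in> Obj C" using Z unfolding is_zero_object_def by blast
    fix Q e assume e: "e \<in> Hom C Z Q" "is_epi C e"
    have QO: "Q \<in> Obj C" using C.Hom_Obj[OF e(1)] by simp
    have "Ide C Q \<cdot>\<^bsub>C\<^esub> e = Null C Z Q"
      using C.zero_object_Hom(1)[OF Z] C.Comp_Hom[OF e(1) C.Ide_Hom[OF QO]] by blast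
    hence "is_zero_object C Q"
      using C.epi_null[OF e(2,1) C.Ide_Hom[OF QO]] C.zero_object_iff[OF QO] by blast
    thus "omap F Q \<in> T" using D.localizing_zero_object[OF univ T] F_zero_object by blast
  qed
  have coprod: "S \<in> ?L" if I: "small U I" and XL: "\<forall>i\<in>I. X i \<in> ?L" and S: "is_coproduct C I X S \<iota>"
    for I :: "'u set" and X S \<iota>
  proof (rule LI)
    show "S \<in> Obj C" using coproduct_Obj[OF S] .
    fix Q e assume e: "e \<in> Hom C S Q" "is_epi C e"
    have "\<forall>i\<in>I. X i \<in> Obj C" using XL by blast
    then obtain K :: "'u set" and r Y \<phi> m
      where K: "small U K" and Q: "is_direct_limit C K r Y \<phi> Q m"
        and Y: "\<And>k. k \<in> K \<Longrightarrow> \<exists>J N \<kappa> d. J \<subseteq> I \<and> finite J \<and> is_coproduct C J X N \<kappa> \<and>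
           d \<in> Hom C N (Y k) \<and> is_epi C d"
      by (rule CU.coproduct_quotient_direct_limit[OF univ I _ S e]) (rule that)
    \<comment> \<open>Each \<open>Y k\<close> is a quotient of a finite coproduct of members of the
      class, which is a member by \<open>zero\<close> and \<open>ext\<close>. Thus
      \<open>F Q\<close> becomes a direct limit of objects of \<open>T\<close>.\<close>
    have "omap F (Y k) \<in> T" if k: "k \<in> K" for k
    proof -
      obtain J N \<kappa> d where J: "J \<subseteq> I" "finite J" and N: "is_coproduct C J X N \<kappa>"
        and d: "d \<in> Hom C N (Y k)" "is_epi C d"
        using Y[OF k] by blast
      have "N \<in> ?L"
        by (rule CU.finite_coproduct_closed[OF zero ext _ J(2) small_mono[OF I J(1)] _ N])
          (use XL J(1) in auto)
      thus ?thesis using LD d by blast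
    qed
    moreover have "is_direct_limit D K r (\<lambda>k. omap F (Y k)) (\<lambda>i j. amap F (\<phi> i j)) (omap F Q)
        (\<lambda>k. amap F (m k))"
      using lim K Q unfolding preserves_direct_limits_def by blast
    ultimately show "omap F Q \<in> T" using DU.localizing_direct_limit[OF T K] by blast
  qed
  show ?thesis
    unfolding localizing_subcategory_def closed_subcategory_def
  proof (intro conjI allI impI)
    show "?L \<subseteq> Obj C" by blast
    fix m assume "is_mono C m" "Cod C m \<in> ?L"
    thus "Dom C m \<in> ?L" using sub C.Arr_Hom unfolding is_mono_def by blast
  next
    fix e assume "is_epi C e" "Dom C e \<in> ?L"
    thus "Cod C e \<in> ?L" using quot C.Arr_Hom unfolding is_epi_def by blast
  next
    fix I :: "'u set" and X S \<iota> assume "small U I" "\<forall>i\<in>I. X i \<in> ?L" "is_coproduct C I X S \<iota>"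
    thus "S \<in> ?L" by (rule coprod)
  next
    fix f g assume "short_exact C f g" "Dom C f \<in> ?L" "Cod C g \<in> ?L"
    thus "Cod C f \<in> ?L" by (rule ext)
  qed
qed

text \<open>The class of \<open>localizing_quotient_preimage\<close> contains \<open>S\<close> and
  hence its localizing closure; applying its condition to the identity of \<open>N\<close>, seen as
  a quotient map, gives back \<open>F N\<close> itself.\<close>

lemma localizing_closure_mapped:
  fixes U :: "'u itself"
  assumes "universe U" "grothendieck_category U C" "grothendieck_category U D"
    and "preserves_direct_limits U C D F" "localizing_subcategory U D T"
    and S: "S \<subseteq> Obj C" "\<And>N e Q. \<lbrakk>N \<in> S; e \<in> Hom C N Q; is_epi C e\<rbrakk> \<Longrightarrow> omap F Q \<in> T"
    and N: "N \<in> localizing_closure U C S"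
  shows "omap F N \<in> T"
proof -
  let ?L = "{N \<in> Obj C. \<forall>Q e. e \<in> Hom C N Q \<longrightarrow> is_epi C e \<longrightarrow> omap F Q \<in> T}"
  have "S \<subseteq> ?L" using S by blast
  hence NL: "N \<in> ?L"
    using localizing_closure_least[OF localizing_quotient_preimage[OF assms(1-5)]] N by blast
  hence "Ide C N \<in> Hom C N N" using C.Ide_Hom by blast
  moreover have "is_epi C (Ide C N)"
    using C.split_epi[OF calculation calculation] C.Comp_Ide[OF calculation] by blast
  ultimately show ?thesis using NL by blast
qed

end

section \<open>Closed objects in a wide Morita context\<close>

context left_wide_Morita_context
begin

sublocale F: left_exact_functor B A F
  by unfold_locales (rule F_left_exact)

sublocale G: left_exact_functor A B G
  by unfold_locales (rule G_left_exact)

text \<open>The axioms are symmetric in the two sides, so each fact below about \<open>\<C>\<close>,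
  \<open>\<eta>\<close> and \<open>G\<close> also yields its mirror image about \<open>\<D>\<close>,
  \<open>\<rho>\<close> and \<open>F\<close>.\<close>

lemma swap: "left_wide_Morita_context B A G F \<rho> \<eta>"
  using B.abelian_category_axioms A.abelian_category_axioms G_left_exact F_left_exact
    \<rho>_natural \<eta>_natural F_\<rho> G_\<eta>
  by (intro left_wide_Morita_context.intro left_wide_Morita_context_axioms.intro)

lemma \<eta>_Hom: "M \<in> Obj A \<Longrightarrow> \<eta> M \<in> Hom A M (omap F (omap G M))"
  using \<eta>_natural unfolding natural_transformation_def id_functor_def comp_functor_def by simp

lemma \<eta>_nat: "f \<in> Hom A M M' \<Longrightarrow> \<eta> M' \<cdot>\<^bsub>A\<^esub> f = amap F (amap G f) \<cdot>\<^bsub>A\<^esub> \<eta> M"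
  using \<eta>_natural unfolding natural_transformation_def id_functor_def comp_functor_def by simp

lemma \<rho>_Hom: "N \<in> Obj B \<Longrightarrow> \<rho> N \<in> Hom B N (omap G (omap F N))"
  using \<rho>_natural unfolding natural_transformation_def id_functor_def comp_functor_def by simp

lemma \<rho>_nat: "f \<in> Hom B N N' \<Longrightarrow> \<rho> N' \<cdot>\<^bsub>B\<^esub> f = amap G (amap F f) \<cdot>\<^bsub>B\<^esub> \<rho> N"
  using \<rho>_natural unfolding natural_transformation_def id_functor_def comp_functor_def by simp

lemma FG_Hom: "f \<in> Hom A M M' \<Longrightarrow> amap F (amap G f) \<in> Hom A (omap F (omap G M)) (omap F (omap G M'))"
  by (intro F.F_Hom G.F_Hom)

lemma FG_Obj: "M \<in> Obj A \<Longrightarrow> omap F (omap G M) \<in> Obj A"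
  by (intro F.F_Obj G.F_Obj)

abbreviation \<C> :: "'oa set" where
  "\<C> \<equiv> vanishing_objects A (comp_functor F G) \<eta>"

abbreviation \<D> :: "'ob set" where
  "\<D> \<equiv> vanishing_objects B (comp_functor G F) \<rho>"

lemma \<C>_iff: "M \<in> \<C> \<longleftrightarrow> M \<in> Obj A \<and> \<eta> M = Null A M (omap F (omap G M))"
  unfolding vanishing_objects_def comp_functor_def by simp

lemma \<D>_iff: "N \<in> \<D> \<longleftrightarrow> N \<in> Obj B \<and> \<rho> N = Null B N (omap G (omap F N))"
  unfolding vanishing_objects_def comp_functor_def by simp

text \<open>By naturality \<open>\<rho> Q\<close> after \<open>e\<close> equals \<open>G F e\<close>
  after the zero morphism \<open>\<rho> N\<close>, and \<open>e\<close> can be cancelled.\<close>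

lemma \<D>_quotient:
  assumes N: "N \<in> \<D>" and e: "e \<in> Hom B N Q" "is_epi B e"
  shows "Q \<in> \<D>"
proof -
  have NO: "N \<in> Obj B" and QO: "Q \<in> Obj B" using B.Hom_Obj[OF e(1)] by auto
  have "\<rho> Q \<cdot>\<^bsub>B\<^esub> e = Null B N (omap G (omap F Q))"
    using \<rho>_nat[OF e(1)] N B.Comp_Null[OF G.F_Hom[OF F.F_Hom[OF e(1)]] NO] unfolding \<D>_iff by simp
  thus ?thesis using B.epi_null[OF e(2,1) \<rho>_Hom[OF QO]] QO unfolding \<D>_iff by blast
qed

lemma F_\<D>:
  assumes "N \<in> \<D>"
  shows "omap F N \<in> \<C>"
proof -
  have N: "N \<in> Obj B" "\<rho> N = Null B N (omap G (omap F N))" using assms unfolding \<D>_iff by auto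
  show ?thesis
    using F_\<rho>[OF N(1)] N(2) F.F_Null[OF N(1)] F.F_Obj[OF N(1)] G.F_Obj[OF F.F_Obj[OF N(1)]]
    unfolding \<C>_iff by simp
qed

text \<open>Naturality at \<open>k\<close> equates \<open>F G k\<close> after
  \<open>\<eta> K\<close> with \<open>\<eta> M\<close> after \<open>k\<close>, which is zero; left
  exactness of both functors keeps \<open>F G k\<close> mono, so \<open>\<eta> K\<close>
  vanishes.\<close>

lemma kernel_\<eta>:
  assumes M: "M \<in> Obj A" and k: "is_kernel A k (\<eta> M)" "k \<in> Hom A K M"
  shows "K \<in> \<C>"
proof -
  note k' = A.is_kernel_iff[OF k(2) \<eta>_Hom[OF M], THEN iffD1, OF k(1)]
  have KO: "K \<in> Obj A" using A.Hom_Obj[OF k(2)] by simp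
  have "is_mono A (amap F (amap G k))"
    using F.F_mono[OF G.F_mono[OF _ k(2)] G.F_Hom[OF k(2)]] k' by blast
  thus ?thesis
    using A.mono_null[OF _ FG_Hom[OF k(2)] \<eta>_Hom[OF KO]] \<eta>_nat[OF k(2)] k' KO unfolding \<C>_iff by simp
qed

lemma \<eta>_FG: "M \<in> Obj A \<Longrightarrow> \<eta> (omap F (omap G M)) = amap F (amap G (\<eta> M))"
  using F_\<rho>[OF G.F_Obj] G_\<eta> by simp

text \<open>Here \<open>\<eta>_FG\<close> replaces right exactness: \<open>\<eta> Q\<close> after
  \<open>q\<close> is \<open>F G q\<close> after \<open>F G (\<eta> M)\<close>, the image under
  \<open>F G\<close> of a zero composite, and \<open>q\<close> is epi.\<close>

lemma cokernel_\<eta>: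
  assumes M: "M \<in> Obj A" and q: "is_cokernel A q (\<eta> M)" "q \<in> Hom A (omap F (omap G M)) Q"
  shows "Q \<in> \<C>"
proof -
  note \<eta>M = \<eta>_Hom[OF M]
  note q' = A.is_cokernel_iff[OF q(2) \<eta>M, THEN iffD1, OF q(1)]
  have QO: "Q \<in> Obj A" using A.Hom_Obj[OF q(2)] by simp
  have "\<eta> Q \<cdot>\<^bsub>A\<^esub> q = amap F (amap G q) \<cdot>\<^bsub>A\<^esub> amap F (amap G (\<eta> M))"
    using \<eta>_nat[OF q(2)] \<eta>_FG[OF M] by simp
  also have "\<dots> = amap F (amap G (q \<cdot>\<^bsub>A\<^esub> \<eta> M))"
    using F.F_Comp[OF G.F_Hom[OF \<eta>M] G.F_Hom[OF q(2)]] G.F_Comp[OF \<eta>M q(2)] by simp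
  also have "\<dots> = Null A (omap F (omap G M)) (omap F (omap G Q))"
    using q' G.F_Null[OF M QO] F.F_Null[OF G.F_Obj[OF M] G.F_Obj[OF QO]] by simp
  finally show ?thesis using A.epi_null[OF _ q(2) \<eta>_Hom[OF QO]] q' QO unfolding \<C>_iff by blast
qed

text \<open>Closedness of \<open>M\<close> yields a retraction \<open>h\<close> of
  \<open>\<eta> M\<close>. That \<open>h\<close> is also a section comes from \<open>F G M\<close>
  receiving only zero morphisms from the cokernel of \<open>\<eta> M\<close>, an object of
  \<open>\<C>\<close>.\<close>

lemma \<eta>_iso_of_closed:
  assumes M: "M \<in> closed_objects A T" and T: "\<C> \<subseteq> T"
  obtains h where "h \<in> Hom A (omap F (omap G M)) M" "h \<cdot>\<^bsub>A\<^esub> \<eta> M = Ide A M"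
    "\<eta> M \<cdot>\<^bsub>A\<^esub> h = Ide A (omap F (omap G M))"
proof -
  let ?FGM = "omap F (omap G M)"
  have MO: "M \<in> Obj A"
    and sub: "\<And>m. \<lbrakk>is_mono A m; Cod A m = M; Dom A m \<in> T\<rbrakk> \<Longrightarrow> is_zero_object A (Dom A m)"
    and ext: "\<And>i q f. \<lbrakk>is_mono A i; is_cokernel A q i; Cod A q \<in> T; f \<in> Hom A (Dom A i) M\<rbrakk>
      \<Longrightarrow> \<exists>h \<in> Hom A (Cod A i) M. h \<cdot>\<^bsub>A\<^esub> i = f"
    using M unfolding closed_objects_def by auto
  note \<eta>M = \<eta>_Hom[OF MO] and IM = A.Ide_Hom[OF MO] and FGO = FG_Obj[OF MO]
  note IFG = A.Ide_Hom[OF FGO]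
  obtain K k where k: "is_kernel A k (\<eta> M)" "k \<in> Hom A K M" using A.kernel[OF \<eta>M] .
  note k' = A.is_kernel_iff[OF k(2) \<eta>M, THEN iffD1, OF k(1)]
  have "K \<in> T" using kernel_\<eta>[OF MO k] T by blast
  hence "is_zero_object A K" using sub[of k] k' A.HomD[OF k(2)] by simp
  hence k0: "k = Null A K M" using A.zero_object_Hom(1) k(2) by blast
  have mono: "is_mono A (\<eta> M)"
  proof (rule A.monoI[OF \<eta>M])
    fix W d assume d: "d \<in> Hom A W M" "\<eta> M \<cdot>\<^bsub>A\<^esub> d = Null A W ?FGM"
    then obtain u where "u \<in> Hom A W K" "k \<cdot>\<^bsub>A\<^esub> u = d" using k' by blast
    thus "d = Null A W M" using k0 A.Null_Comp MO by simp
  qed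
  obtain Q q where q: "is_cokernel A q (\<eta> M)" "q \<in> Hom A ?FGM Q" using A.cokernel[OF \<eta>M] .
  note q' = A.is_cokernel_iff[OF q(2) \<eta>M, THEN iffD1, OF q(1)]
  have QC: "Q \<in> \<C>" using cokernel_\<eta>[OF MO q] .
  hence QO: "Q \<in> Obj A" unfolding \<C>_iff by blast
  obtain h where h: "h \<in> Hom A ?FGM M" "h \<cdot>\<^bsub>A\<^esub> \<eta> M = Ide A M"
    using ext[OF mono q(1), of "Ide A M"] A.HomD[OF q(2)] A.HomD[OF \<eta>M] QC T IM by auto
  have \<eta>h: "\<eta> M \<cdot>\<^bsub>A\<^esub> h \<in> Hom A ?FGM ?FGM" using A.Comp_Hom[OF h(1) \<eta>M] .
  \<comment> \<open>\<open>d\<close> is the defect of \<open>h\<close> as a right inverse, the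
    identity minus \<open>\<eta> M\<close> after \<open>h\<close>. It kills \<open>\<eta> M\<close>
    and so factors through the cokernel \<open>Q\<close>.\<close>
  obtain d where d: "d \<in> Hom A ?FGM ?FGM" "d \<oplus>\<^bsub>A\<^esub> \<eta> M \<cdot>\<^bsub>A\<^esub> h = Ide A ?FGM"
    using A.difference[OF IFG \<eta>h] .
  have "d \<cdot>\<^bsub>A\<^esub> \<eta> M \<oplus>\<^bsub>A\<^esub> \<eta> M = \<eta> M"
    using A.Add_Comp[OF \<eta>M d(1) \<eta>h] d(2) A.Comp_assoc[OF \<eta>M h(1) \<eta>M] h(2) A.Comp_Ide[OF \<eta>M]
      A.Ide_Comp[OF \<eta>M] by simp
  hence "d \<cdot>\<^bsub>A\<^esub> \<eta> M = Null A M ?FGM" using A.Add_cancel[OF A.Comp_Hom[OF \<eta>M d(1)] \<eta>M] by blast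
  then obtain s where s: "s \<in> Hom A Q ?FGM" "s \<cdot>\<^bsub>A\<^esub> q = d" using q' d(1) by blast
  have "amap F (amap G h) \<cdot>\<^bsub>A\<^esub> \<eta> ?FGM = Ide A ?FGM"
    using \<eta>_FG[OF MO] F.F_Comp[OF G.F_Hom[OF \<eta>M] G.F_Hom[OF h(1)]] G.F_Comp[OF \<eta>M h(1)] h(2)
      G.F_Ide[OF MO] F.F_Ide[OF G.F_Obj[OF MO]] by simp
  hence "is_mono A (\<eta> ?FGM)" using A.split_mono[OF \<eta>_Hom[OF FGO] FG_Hom[OF h(1)]] by blast
  \<comment> \<open>Naturality at \<open>s\<close> moves \<eta> to \<open>Q\<close>, where it
    vanishes. As \<eta> at \<open>F G M\<close> is mono, split by \<open>F G h\<close>, the factor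
    \<open>s\<close> and with it the defect \<open>d\<close> are zero.\<close>
  moreover have "\<eta> ?FGM \<cdot>\<^bsub>A\<^esub> s = Null A Q (omap F (omap G ?FGM))"
    using \<eta>_nat[OF s(1)] QC A.Comp_Null[OF FG_Hom[OF s(1)] QO] unfolding \<C>_iff by simp
  ultimately have "s = Null A Q ?FGM" using A.mono_null[OF _ \<eta>_Hom[OF FGO] s(1)] by blast
  hence "d = Null A ?FGM ?FGM" using s(2) A.Null_Comp[OF q(2) FGO] by simp
  hence "\<eta> M \<cdot>\<^bsub>A\<^esub> h = Ide A ?FGM" using d(2) A.Null_Add[OF \<eta>h] by simp
  thus thesis using that h by blast
qed

text \<open>With \<theta> the inverse of \<open>\<eta> M\<close>, a morphism from \<open>X\<close>
  to \<open>G M\<close> is determined by its transport from \<open>F X\<close> to \<open>M\<close>.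
  Questions about \<open>T'\<close> and \<open>G M\<close> thereby turn into questions about
  \<open>T\<close> and \<open>M\<close>, provided that \<open>F\<close> sends \<open>T'\<close> into
  \<open>T\<close>.\<close>

lemma G_closed:
  assumes M: "M \<in> closed_objects A T" and T: "localizing_subcategory U A T" "\<C> \<subseteq> T"
    and F_T': "\<And>N. N \<in> T' \<Longrightarrow> omap F N \<in> T"
  shows "omap G M \<in> closed_objects B T'"
proof -
  let ?FGM = "omap F (omap G M)"
  have MO: "M \<in> Obj A"
    and sub: "\<And>m. \<lbrakk>is_mono A m; Cod A m = M; Dom A m \<in> T\<rbrakk> \<Longrightarrow> is_zero_object A (Dom A m)"
    and ext: "\<And>i q f. \<lbrakk>is_mono A i; is_cokernel A q i; Cod A q \<in> T; f \<in> Hom A (Dom A i) M\<rbrakk>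
      \<Longrightarrow> \<exists>h \<in> Hom A (Cod A i) M. h \<cdot>\<^bsub>A\<^esub> i = f"
    using M unfolding closed_objects_def by auto
  note \<eta>M = \<eta>_Hom[OF MO] and GO = G.F_Obj[OF MO] and FGO = FG_Obj[OF MO]
  obtain \<theta> where \<theta>: "\<theta> \<in> Hom A ?FGM M" "\<theta> \<cdot>\<^bsub>A\<^esub> \<eta> M = Ide A M" "\<eta> M \<cdot>\<^bsub>A\<^esub> \<theta> = Ide A ?FGM"
    using \<eta>_iso_of_closed[OF M T(2)] .
  have G\<theta>: "amap G \<theta> \<cdot>\<^bsub>B\<^esub> \<rho> (omap G M) = Ide B (omap G M)"
    using G_\<eta>[OF MO] G.F_Comp[OF \<eta>M \<theta>(1)] \<theta>(2) G.F_Ide[OF MO] by simp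
  have G\<theta>_Hom: "amap G \<theta> \<in> Hom B (omap G ?FGM) (omap G M)" using G.F_Hom[OF \<theta>(1)] .
  \<comment> \<open>\<open>G \<theta>\<close> inverts \<rho> at \<open>G M\<close> on the left
    because \<open>\<rho> (G M) = G (\<eta> M)\<close>; naturality of \<rho> then pushes
    \<open>f\<close> through \<rho>.\<close>
  have retract: "f = amap G (\<theta> \<cdot>\<^bsub>A\<^esub> amap F f) \<cdot>\<^bsub>B\<^esub> \<rho> X" if f: "f \<in> Hom B X (omap G M)" for f X
  proof -
    have XO: "X \<in> Obj B" using B.Hom_Obj[OF f] by simp
    have "f = (amap G \<theta> \<cdot>\<^bsub>B\<^esub> \<rho> (omap G M)) \<cdot>\<^bsub>B\<^esub> f" using G\<theta> B.Ide_Comp[OF f] by simp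
    also have "\<dots> = amap G \<theta> \<cdot>\<^bsub>B\<^esub> (amap G (amap F f) \<cdot>\<^bsub>B\<^esub> \<rho> X)"
      using B.Comp_assoc[OF f \<rho>_Hom[OF GO] G\<theta>_Hom] \<rho>_nat[OF f] by simp
    also have "\<dots> = amap G (\<theta> \<cdot>\<^bsub>A\<^esub> amap F f) \<cdot>\<^bsub>B\<^esub> \<rho> X"
      using B.Comp_assoc[OF \<rho>_Hom[OF XO] G.F_Hom[OF F.F_Hom[OF f]] G\<theta>_Hom]
        G.F_Comp[OF F.F_Hom[OF f] \<theta>(1)] by simp
    finally show ?thesis .
  qed
  have \<theta>_mono: "is_mono A \<theta>" using A.split_mono[OF \<theta>(1) \<eta>M \<theta>(3)] .
  have torsionfree: "is_zero_object B X" if m: "is_mono B m" "m \<in> Hom B X (omap G M)" and X: "X \<in> T'" for m X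
  proof -
    have XO: "X \<in> Obj B" using B.Hom_Obj[OF m(2)] by simp
    have FX: "omap F X \<in> T" using F_T'[OF X] .
    have Fm: "amap F m \<in> Hom A (omap F X) ?FGM" "is_mono A (amap F m)"
      using F.F_Hom[OF m(2)] F.F_mono[OF m] by auto
    have \<theta>m: "\<theta> \<cdot>\<^bsub>A\<^esub> amap F m \<in> Hom A (omap F X) M" using A.Comp_Hom[OF Fm(1) \<theta>(1)] .
    have "is_mono A (\<theta> \<cdot>\<^bsub>A\<^esub> amap F m)"
    proof (rule A.monoI[OF \<theta>m])
      fix W d assume d: "d \<in> Hom A W (omap F X)" "(\<theta> \<cdot>\<^bsub>A\<^esub> amap F m) \<cdot>\<^bsub>A\<^esub> d = Null A W M"
      have "amap F m \<cdot>\<^bsub>A\<^esub> d = Null A W ?FGM"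
        using A.mono_null[OF \<theta>_mono \<theta>(1) A.Comp_Hom[OF d(1) Fm(1)]] A.Comp_assoc[OF d(1) Fm(1) \<theta>(1)] d(2)
        by simp
      thus "d = Null A W (omap F X)" using A.mono_null[OF Fm(2,1) d(1)] by blast
    qed
    \<comment> \<open>\<open>F X\<close> is a subobject of \<open>M\<close> lying in
      \<open>T\<close>, hence zero. This does not directly make \<open>X\<close> zero, but by
      \<open>retract\<close> it makes the monomorphism \<open>m\<close> zero.\<close>
    hence "is_zero_object A (omap F X)" using sub A.HomD[OF \<theta>m] FX by metis
    hence "\<theta> \<cdot>\<^bsub>A\<^esub> amap F m = Null A (omap F X) M" using A.zero_object_Hom(1) \<theta>m by blast
    hence "m = Null B X (omap G M)"
      using retract[OF m(2)] G.F_Null[OF F.F_Obj[OF XO] MO] B.Null_Comp[OF \<rho>_Hom[OF XO] GO] by simp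
    hence "m \<cdot>\<^bsub>B\<^esub> Ide B X = Null B X (omap G M)" using B.Comp_Ide[OF m(2)] by simp
    thus ?thesis using B.mono_null[OF m B.Ide_Hom[OF XO]] B.zero_object_iff[OF XO] by blast
  qed
  have extend: "\<exists>h \<in> Hom B Y (omap G M). h \<cdot>\<^bsub>B\<^esub> i = f"
    if i: "is_mono B i" "i \<in> Hom B X Y" and q: "is_cokernel B q i" "q \<in> Hom B Y Q" "Q \<in> T'"
      and f: "f \<in> Hom B X (omap G M)" for i q f X Y Q
  proof -
    have XO: "X \<in> Obj B" and YO: "Y \<in> Obj B" using B.Hom_Obj[OF i(2)] by auto
    have Fi: "amap F i \<in> Hom A (omap F X) (omap F Y)" "is_mono A (amap F i)"
      using F.F_Hom[OF i(2)] F.F_mono[OF i] by auto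
    have Fq: "amap F q \<in> Hom A (omap F Y) (omap F Q)" using F.F_Hom[OF q(2)] .
    have ker: "is_kernel A (amap F i) (amap F q)"
      using F.F_kernel B.mono_kernel_of_cokernel[OF i q(1)] by blast
    \<comment> \<open>\<open>F q\<close> need not be a cokernel of \<open>F i\<close>. Its coimage
      part \<open>e\<close> is one, and the cokernel object \<open>I\<close> lies in
      \<open>T\<close> as a subobject of \<open>F Q\<close>.\<close>
    obtain I e m where e: "e \<in> Hom A (omap F Y) I" "short_exact A (amap F i) e"
      and m: "m \<in> Hom A I (omap F Q)" "is_mono A m"
      using A.image_factorization[OF Fq ker] by metis
    have "I \<in> T" using A.localizing_subobject[OF T(1) m(2,1) F_T'[OF q(3)]] .
    moreover have "\<theta> \<cdot>\<^bsub>A\<^esub> amap F f \<in> Hom A (omap F X) M" using A.Comp_Hom[OF F.F_Hom[OF f] \<theta>(1)] .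
    ultimately obtain h where h: "h \<in> Hom A (omap F Y) M" "h \<cdot>\<^bsub>A\<^esub> amap F i = \<theta> \<cdot>\<^bsub>A\<^esub> amap F f"
      using ext[OF Fi(2), of e "\<theta> \<cdot>\<^bsub>A\<^esub> amap F f"] e(2) A.HomD[OF e(1)] A.HomD[OF Fi(1)]
      unfolding short_exact_def by auto
    \<comment> \<open>The solution in \<open>A\<close> comes back as \<open>G h\<close> after
      \<open>\<rho> Y\<close>; naturality at \<open>i\<close> reduces its restriction along
      \<open>i\<close> to the formula in \<open>retract\<close>.\<close>
    have "(amap G h \<cdot>\<^bsub>B\<^esub> \<rho> Y) \<cdot>\<^bsub>B\<^esub> i = amap G h \<cdot>\<^bsub>B\<^esub> (amap G (amap F i) \<cdot>\<^bsub>B\<^esub> \<rho> X)"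
      using B.Comp_assoc[OF i(2) \<rho>_Hom[OF YO] G.F_Hom[OF h(1)]] \<rho>_nat[OF i(2)] by simp
    also have "\<dots> = amap G (\<theta> \<cdot>\<^bsub>A\<^esub> amap F f) \<cdot>\<^bsub>B\<^esub> \<rho> X"
      using B.Comp_assoc[OF \<rho>_Hom[OF XO] G.F_Hom[OF Fi(1)] G.F_Hom[OF h(1)]]
        G.F_Comp[OF Fi(1) h(1)] h(2) by simp
    also have "\<dots> = f" using retract[OF f] by simp
    finally show ?thesis using B.Comp_Hom[OF \<rho>_Hom[OF YO] G.F_Hom[OF h(1)]] by blast
  qed
  show ?thesis
    unfolding closed_objects_def
  proof (intro CollectI conjI allI impI ballI)
    show "omap G M \<in> Obj B" by (rule GO)
    fix m assume "is_mono B m" "Cod B m = omap G M" "Dom B m \<in> T'"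
    thus "is_zero_object B (Dom B m)"
      using torsionfree[of m "Dom B m"] unfolding is_mono_def Hom_def by blast
  next
    fix i q f assume "is_mono B i" "is_cokernel B q i" "Cod B q \<in> T'" "f \<in> Hom B (Dom B i) (omap G M)"
    thus "\<exists>h \<in> Hom B (Cod B i) (omap G M). h \<cdot>\<^bsub>B\<^esub> i = f"
      using extend[of i "Dom B i" "Cod B i" q "Cod B q" f]
      unfolding is_cokernel_def is_mono_def Hom_def by blast
  qed
qed

text \<open>Quotients of objects of \<open>\<D>\<close> stay in \<open>\<D>\<close> and are sent
  into \<open>\<C>\<close>, so the strengthened condition of
  \<open>localizing_closure_mapped\<close> holds on the generating class.\<close>

lemma F_localizing_closure:
  fixes U :: "'u itself"
  assumes "universe U" "grothendieck_category U A" "grothendieck_category U B"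
    and "preserves_direct_limits U B A F"
    and N: "N \<in> localizing_closure U B \<D>"
  shows "omap F N \<in> localizing_closure U A \<C>"
proof -
  have "\<C> \<subseteq> Obj A" and D: "\<D> \<subseteq> Obj B" unfolding vanishing_objects_def by auto
  hence T: "localizing_subcategory U A (localizing_closure U A \<C>)"
    by (intro A.localizing_closure_localizing)
  have "omap F Q \<in> localizing_closure U A \<C>" if "N \<in> \<D>" "e \<in> Hom B N Q" "is_epi B e" for N e Q
    by (rule subsetD[OF localizing_closure_superset F_\<D>[OF \<D>_quotient[OF that]]])
  thus ?thesis by (rule F.localizing_closure_mapped[OF assms(1,3,2,4) T D _ N])
qed

section \<open>Restriction of the functors and of \<eta> to the quotient categories\<close>

lemma \<eta>_natural_isomorphism:
  assumes T: "\<C> \<subseteq> T" and FG: "\<And>M. M \<in> closed_objects A T \<Longrightarrow> omap F (omap G M) \<in> closed_objects A T"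
  shows "natural_isomorphism (quotient_category A T) (quotient_category A T) id_functor (comp_functor F G) \<eta>"
proof -
  let ?Q = "quotient_category A T"
  have Q: "Obj ?Q = closed_objects A T" "Comp ?Q = Comp A" "Ide ?Q = Ide A"
    unfolding quotient_category_def full_subcategory_def closed_objects_def by auto
  have HomQ: "Hom ?Q X Y = {f \<in> Hom A X Y. X \<in> closed_objects A T \<and> Y \<in> closed_objects A T}" for X Y
    unfolding quotient_category_def full_subcategory_def Hom_def by auto
  have closed: "M \<in> Obj A" if "M \<in> closed_objects A T" for M
    using that unfolding closed_objects_def by blast
  have \<eta>Q: "\<eta> M \<in> Hom ?Q M (omap F (omap G M))" if "M \<in> closed_objects A T" for M
    using \<eta>_Hom[OF closed[OF that]] that FG unfolding HomQ by blast
  have "is_iso ?Q (\<eta> M)" if M: "M \<in> closed_objects A T" for M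
  proof -
    obtain h where h: "h \<in> Hom A (omap F (omap G M)) M" "h \<cdot>\<^bsub>A\<^esub> \<eta> M = Ide A M"
      "\<eta> M \<cdot>\<^bsub>A\<^esub> h = Ide A (omap F (omap G M))"
      using \<eta>_iso_of_closed[OF M T] .
    \<comment> \<open>The quotient category is represented by a full subcategory, so the inverse
      found in \<open>A\<close> belongs to it.\<close>
    have "h \<in> Hom ?Q (omap F (omap G M)) M" using h(1) M FG unfolding HomQ by blast
    thus ?thesis using h(2,3) \<eta>Q[OF M] unfolding is_iso_def Q Hom_def by auto
  qed
  thus ?thesis
    using \<eta>Q \<eta>_nat
    unfolding natural_isomorphism_def natural_transformation_def Q HomQ id_functor_def comp_functor_def
    by simp
qed

lemma F_additive_quotient:
  assumes "\<And>N. N \<in> closed_objects B T' \<Longrightarrow> omap F N \<in> closed_objects A T"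
  shows "additive_functor (quotient_category B T') (quotient_category A T) F"
proof -
  \<comment> \<open>Polymorphic in the category, because it is applied to \<open>A\<close> and to
    \<open>B\<close>.\<close>
  have HomQ: "Hom (quotient_category X S) M N =
      {f \<in> Hom X M N. M \<in> closed_objects X S \<and> N \<in> closed_objects X S}"
    for X :: "('x, 'y) addcat" and S M N
    unfolding quotient_category_def full_subcategory_def Hom_def by auto
  have Q: "Obj (quotient_category X S) = closed_objects X S"
      "Comp (quotient_category X S) = Comp X" "Ide (quotient_category X S) = Ide X"
      "Add (quotient_category X S) = Add X" for X :: "('x, 'y) addcat" and S
    unfolding quotient_category_def full_subcategory_def closed_objects_def by auto
  show ?thesis
    unfolding additive_functor_def HomQ Q
  proof (intro conjI allI ballI)
    show "amap F (Ide B N) = Ide A (omap F N)" if "N \<in> closed_objects B T'" for N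
      using F.F_Ide that unfolding closed_objects_def by blast
  qed (use assms F.F_Hom F.F_Comp F.F_Add in blast)+
qed

end

theorem theorem7p5:
  fixes U :: "'u itself"
    and A :: "('oa, 'ma) addcat" and B :: "('ob, 'mb) addcat"
    and F :: "('ob, 'mb, 'oa, 'ma) funct" and G :: "('oa, 'ma, 'ob, 'mb) funct"
    and \<eta> :: "'oa \<Rightarrow> 'ma" and \<rho> :: "'ob \<Rightarrow> 'mb"
  assumes "universe U"
    and "grothendieck_category U A" and "grothendieck_category U B"
    and "left_wide_Morita_context A B F G \<eta> \<rho>"
    and "preserves_direct_limits U B A F" and "preserves_direct_limits U A B G"
  shows "inverse_equivalences
           (quotient_category A (localizing_closure U A (vanishing_objects A (comp_functor F G) \<eta>)))
           (quotient_category B (localizing_closure U B (vanishing_objects B (comp_functor G F) \<rho>)))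
           F G"
proof -
  interpret AB: left_wide_Morita_context A B F G \<eta> \<rho> by fact
  interpret BA: left_wide_Morita_context B A G F \<rho> \<eta> by (rule AB.swap)
  let ?S = "localizing_closure U A AB.\<C>" and ?T = "localizing_closure U B AB.\<D>"
  have "AB.\<C> \<subseteq> Obj A" "AB.\<D> \<subseteq> Obj B" unfolding vanishing_objects_def by auto
  hence S: "AB.\<C> \<subseteq> ?S" "localizing_subcategory U A ?S"
    and T: "AB.\<D> \<subseteq> ?T" "localizing_subcategory U B ?T"
    using AB.A.localizing_closure_localizing AB.B.localizing_closure_localizing
    by (simp_all add: localizing_closure_superset)
  \<comment> \<open>The roles cross: that \<open>G\<close> preserves closed objects rests on
    \<open>F\<close> sending the closure of \<open>\<D>\<close> into that of \<open>\<C>\<close>,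
    hence on \<open>F\<close> commuting with direct limits. The swapped context gives the other
    half.\<close>
  have G: "omap G M \<in> closed_objects B ?T" if "M \<in> closed_objects A ?S" for M
    using AB.G_closed[OF that S(2,1)] AB.F_localizing_closure assms by blast
  have F: "omap F N \<in> closed_objects A ?S" if "N \<in> closed_objects B ?T" for N
    using BA.G_closed[OF that T(2,1)] BA.F_localizing_closure assms by blast
  show ?thesis
    unfolding inverse_equivalences_def
  proof (intro conjI exI)
    show "additive_functor (quotient_category B ?T) (quotient_category A ?S) F"
      by (rule AB.F_additive_quotient[OF F])
    show "additive_functor (quotient_category A ?S) (quotient_category B ?T) G"
      by (rule BA.F_additive_quotient[OF G])
    show "natural_isomorphism (quotient_category A ?S) (quotient_category A ?S) id_functor
        (comp_functor F G) \<eta>"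
      by (rule AB.\<eta>_natural_isomorphism[OF S(1) F[OF G]])
    show "natural_isomorphism (quotient_category B ?T) (quotient_category B ?T) id_functor
        (comp_functor G F) \<rho>"
      by (rule BA.\<eta>_natural_isomorphism[OF T(1) G[OF F]])
  qed
qed

end
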